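(* Let $\mathscr G=\left\{\sum_{n=0}^\infty f_n\xi_n:\ \sum_{n\in\mathbb N_0}|f_n|^22^{np}<\infty\text{ for all }p\in\mathbb N\right\}\subset\mathscr S$, where $(\xi_n)_{n\in\mathbb N_0}$ are the Hermite functions. Then its dual $\mathscr G'$ is a Våge space containing the Schwartz space $\mathscr S'$ of tempered distributions.
   Context: $\mathbb N=\{1,2,\dots\}$, $\mathbb N_0=\mathbb N\cup\{0\}$. Hermite functions: $\xi_n(x)=\pi^{-1/4}(2^nn!)^{-1/2}e^{-x^2/2}h_n(x)$ with $h_n(x)=(-1)^ne^{x^2}\frac{d^n}{dx^n}(e^{-x^2})$; they form an orthonormal basis of $\mathbf L_2(\mathbb R,dx)$. $\mathscr S$ is the Schwartz space of smooth rapidly decreasing complex functions on $\mathbb R$. Identifying $\sum_nf_n\xi_n$ with $(f_n)_{n\in\mathbb N_0}$, $\mathscr S$ is $\mathcal F_a$ for $a_n=(n+1)^2$, and $\mathscr G$ is $\mathcal F_a$ for $a_n=2^n$, where for a positive function $a:\mathbb N_0\to\mathbb R$, $\mathcal F_a=\{(\varphi_n):\sum_n|\varphi_n|^2a_n^p<\infty\ \forall p\in\mathbb N\}$ is a Fréchet space with the corresponding norms, with dual $\mathcal F_a'=\bigcup_{p\in\mathbb N}\ell^2_{a^{-p}}$, $\ell^2_{a^{-p}}=\{f=(f_n):\|f\|_p<\infty\}$, $\|f\|_p=(\sum_n|f_n|^2a_n^{-p})^{1/2}$. In this way $\mathscr S'$ and $\mathscr G'$ are identified with spaces of sequences. Such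 $a$ is admissible if $a_0=1$ and $a_1>1$ and $d$-regular ($d\in\mathbb N$) if in addition $\frac1{a_1^d-1}<\infty$ (the general condition $\sum_{n\in A}\frac1{a_{e_n}^d-1}<\infty$ for the index set $A=\{1\}$, $\ell_A=\mathbb N_0$); $\mathcal F_a'$ is then called regular admissible. Convolution: $f*g=(\sum_{m\le n}f_mg_{n-m})_{n\in\mathbb N_0}$. A regular admissible space $\mathcal F_a'$ is a Våge space if there is $e\in\mathbb N$ and finite positive numbers $A(k)$, $k\ge e$, such that for all $q\in\mathbb N$ and all $p\ge q+e$, $\|f*g\|_p\le A(p-q)\|f\|_q\|g\|_p$ for all $f\in\ell^2_{a^{-q}}$ and $g\in\ell^2_{a^{-p}}$. *)

theory Defs
  imports "HOL-Analysis.Analysis"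
begin

section \<open>Continuous duals of spaces of complex-valued functions\<close>

text \<open>The coarsest topology on \<open>X\<close> making all translates of all seminorms in \<open>P\<close> continuous, that is,
  the usual topology defined by a family of seminorms; the open balls form a subbase.\<close>

definition seminorm_topology ::
    "('i \<Rightarrow> complex) set \<Rightarrow> (('i \<Rightarrow> complex) \<Rightarrow> real) set \<Rightarrow> ('i \<Rightarrow> complex) topology" where
  "seminorm_topology X P = topology_generated_by
     {{g \<in> X. \<rho> (\<lambda>i. g i - f i) < \<epsilon>} | \<rho> f \<epsilon>. \<rho> \<in> P \<and> f \<in> X \<and> \<epsilon> > 0}"

text \<open>Functionals are total functions in HOL; \<open>extensional X\<close> normalises their values outside \<open>X\<close>, so
  that two functionals are equal iff they agree on \<open>X\<close>.\<close>

definition continuous_dual ::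
    "('i \<Rightarrow> complex) set \<Rightarrow> (('i \<Rightarrow> complex) \<Rightarrow> real) set \<Rightarrow> (('i \<Rightarrow> complex) \<Rightarrow> complex) set" where
  "continuous_dual X P =
     {T \<in> extensional X.
        (\<forall>f\<in>X. \<forall>g\<in>X. T (\<lambda>i. f i + g i) = T f + T g) \<and>
        (\<forall>c. \<forall>f\<in>X. T (\<lambda>i. c * f i) = c * T f) \<and>
        continuous_map (seminorm_topology X P) euclidean T}"

section \<open>Weighted sequence spaces and Vage spaces\<close>

text \<open>\<open>wl2 a k\<close> is the weighted space with weight \<open>a\<^sup>k\<close>, for an integer \<open>k\<close> of either sign. In the
  notation of the theory of Vage spaces, \<open>\<parallel>f\<parallel>\<^sub>p\<close> is \<open>wnorm a (- int p) f\<close>.\<close>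

definition wl2 :: "(nat \<Rightarrow> real) \<Rightarrow> int \<Rightarrow> (nat \<Rightarrow> complex) set" where
  "wl2 a k = {f. summable (\<lambda>n. (norm (f n))\<^sup>2 * a n powi k)}"

definition wnorm :: "(nat \<Rightarrow> real) \<Rightarrow> int \<Rightarrow> (nat \<Rightarrow> complex) \<Rightarrow> real" where
  "wnorm a k f = sqrt (\<Sum>n. (norm (f n))\<^sup>2 * a n powi k)"

definition seq_space :: "(nat \<Rightarrow> real) \<Rightarrow> (nat \<Rightarrow> complex) set" where
  "seq_space a = (\<Inter>p\<in>{1..}. wl2 a (int p))"

definition seq_space_dual :: "(nat \<Rightarrow> real) \<Rightarrow> (nat \<Rightarrow> complex) set" where
  "seq_space_dual a = (\<Union>p\<in>{1..}. wl2 a (- int p))"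

definition admissible :: "(nat \<Rightarrow> real) \<Rightarrow> bool" where
  "admissible a \<longleftrightarrow> (\<forall>n. a n > 0) \<and> a 0 = 1 \<and> a 1 > 1"

text \<open>For general index sets the regularity condition bounds a sum with one term per variable. Here
  there is a single variable, hence a single term.\<close>

definition regular :: "nat \<Rightarrow> (nat \<Rightarrow> real) \<Rightarrow> bool" where
  "regular d a \<longleftrightarrow> admissible a \<and> 1 / ereal (a 1 ^ d - 1) < \<infinity>"

definition seq_conv :: "(nat \<Rightarrow> complex) \<Rightarrow> (nat \<Rightarrow> complex) \<Rightarrow> nat \<Rightarrow> complex" where
  "seq_conv f g n = (\<Sum>m\<le>n. f m * g (n - m))"

text \<open>\<open>vage_space a\<close> says that the space \<open>seq_space_dual a\<close> is a Vage space. The membership of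
  \<open>seq_conv f g\<close> in \<open>wl2 a (- int p)\<close> is the finiteness of the left-hand norm; without it the
  inequality would say nothing about divergent series, for which \<open>suminf\<close> is unspecified.\<close>

definition vage_space :: "(nat \<Rightarrow> real) \<Rightarrow> bool" where
  "vage_space a \<longleftrightarrow> (\<exists>d\<ge>1. regular d a) \<and>
     (\<exists>e\<ge>1. \<exists>A :: nat \<Rightarrow> real. (\<forall>k\<ge>e. A k > 0) \<and>
       (\<forall>q\<ge>1. \<forall>p\<ge>q + e. \<forall>f\<in>wl2 a (- int q). \<forall>g\<in>wl2 a (- int p).
          seq_conv f g \<in> wl2 a (- int p) \<and>
          wnorm a (- int p) (seq_conv f g)
            \<le> A (p - q) * wnorm a (- int q) f * wnorm a (- int p) g))"

section \<open>Schwartz space and tempered distributions\<close>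

definition nth_deriv :: "nat \<Rightarrow> (real \<Rightarrow> complex) \<Rightarrow> real \<Rightarrow> complex" where
  "nth_deriv j = (\<lambda>\<phi> x. vector_derivative \<phi> (at x)) ^^ j"

definition Schwartz :: "(real \<Rightarrow> complex) set" where
  "Schwartz = {\<phi>. (\<forall>j x. nth_deriv j \<phi> differentiable at x) \<and>
     (\<forall>k j. bounded (range (\<lambda>x. of_real (x ^ k) * nth_deriv j \<phi> x)))}"

definition Schwartz_seminorm :: "nat \<Rightarrow> nat \<Rightarrow> (real \<Rightarrow> complex) \<Rightarrow> real" where
  "Schwartz_seminorm k j \<phi> = (SUP x. norm (of_real (x ^ k) * nth_deriv j \<phi> x))"

definition tempered_distributions :: "((real \<Rightarrow> complex) \<Rightarrow> complex) set" where
  "tempered_distributions = continuous_dual Schwartz {Schwartz_seminorm k j | k j. True}"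

section \<open>Hermite functions and the space G\<close>

definition hermite_poly :: "nat \<Rightarrow> real \<Rightarrow> real" where
  "hermite_poly n x = (-1) ^ n * exp (x\<^sup>2) * (deriv ^^ n) (\<lambda>t. exp (- t\<^sup>2)) x"

definition hermite_fun :: "nat \<Rightarrow> real \<Rightarrow> complex" where
  "hermite_fun n x = of_real
     (pi powr (-1/4) * (2 ^ n * fact n) powr (-1/2) * exp (- x\<^sup>2 / 2) * hermite_poly n x)"

text \<open>The elements of \<open>G_space\<close> are functions on the line, given as pointwise sums: these series converge
  absolutely and uniformly, so the pointwise sum is the continuous representative of the
  sum in the square-integrable functions.\<close>

definition G_space :: "(real \<Rightarrow> complex) set" where
  "G_space = {\<phi>. \<exists>f\<in>seq_space (\<lambda>n. 2 ^ n). \<forall>x. (\<lambda>n. f n * hermite_fun n x) sums \<phi> x}"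

text \<open>The coefficients with respect to the orthonormal system of the (real-valued) Hermite functions;
  they recover \<open>f\<close> from \<open>\<phi>\<close> in the definition of \<open>G_space\<close>.\<close>

definition hermite_coeff :: "(real \<Rightarrow> complex) \<Rightarrow> nat \<Rightarrow> complex" where
  "hermite_coeff \<phi> n = (LINT x|lborel. \<phi> x * hermite_fun n x)"

definition G_norm :: "nat \<Rightarrow> (real \<Rightarrow> complex) \<Rightarrow> real" where
  "G_norm p \<phi> = wnorm (\<lambda>n. 2 ^ n) (int p) (hermite_coeff \<phi>)"

definition G_dual :: "((real \<Rightarrow> complex) \<Rightarrow> complex) set" where
  "G_dual = continuous_dual G_space {G_norm p | p. p \<ge> 1}"

text \<open>The identification of functionals with sequences: \<open>T\<close> corresponds to the sequence \<open>t\<close> with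
  \<open>T (\<Sum>n. f n * hermite_fun n) = (\<Sum>n. t n * f n)\<close>.\<close>

definition dual_coeff :: "((real \<Rightarrow> complex) \<Rightarrow> complex) \<Rightarrow> nat \<Rightarrow> complex" where
  "dual_coeff T n = T (hermite_fun n)"

end

theory Submission
  imports Defs "HOL-Probability.Distributions"
begin

text \<open>The operators \<open>x \<plusminus> d/dx\<close> shift the index of a Hermite function up to a factor of order
  \<open>\<surd>n\<close>. Hence all Schwartz seminorms of the \<open>n\<close>-th Hermite function grow polynomially in \<open>n\<close>, and
  the Hermite coefficients of a Schwartz function decay faster than any power of \<open>n\<close>. So series with
  rapidly decreasing coefficients converge in the Schwartz space, the elements of \<open>G\<close> are such series,
  and the Schwartz seminorms are dominated on \<open>G\<close> by the norms of \<open>G\<close>. As the Hermite functions are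
  complete, every Schwartz function is the sum of its Hermite series in the Schwartz topology;
  therefore a tempered distribution is determined by its values on the Hermite functions, which lie
  in \<open>G\<close>. The weights \<open>2\<^sup>n\<close> are multiplicative in \<open>n\<close>, so the Vage inequality is Young's
  inequality \<open>\<parallel>u * v\<parallel>\<^sub>2 \<le> \<parallel>u\<parallel>\<^sub>1 \<parallel>v\<parallel>\<^sub>2\<close> for the weighted sequences.\<close>

section \<open>Schwartz functions\<close>

text \<open>The obstacle is completeness of the Hermite functions. It is proved for Schwartz
  functions only and without the Fourier transform. A Schwartz function with vanishing coefficients
  is orthogonal to every polynomial times exp (- x^2 / 2). Expanding an exponential factor into its
  power series trades the polynomials for narrower Gaussians and then for translated ones, and these
  concentrate at a point. Growth in \<open>n\<close> is estimated crudely throughout, since any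
  polynomial bound is absorbed by the decay of the coefficients; even the sup bound on a Hermite
  function comes from L2 norms alone. In the Vage inequality the gap p - q \<ge> 1 makes the square
  root of the weight at p smaller than that at q by r^n with r = 2^(-(p - q) / 2) < 1. Summing the
  geometric series in r gives e = 1 and A(k) = 1 / (1 - 2^(-k / 2)).\<close>

definition deriv_seq :: "(nat \<Rightarrow> real \<Rightarrow> complex) \<Rightarrow> (real \<Rightarrow> complex) \<Rightarrow> bool" where
  "deriv_seq F \<phi> \<longleftrightarrow> F 0 = \<phi> \<and> (\<forall>j x. (F j has_vector_derivative F (Suc j) x) (at x))"

lemma nth_deriv_0 [simp]: "nth_deriv 0 \<phi> = \<phi>"
  by (simp add: nth_deriv_def)

lemma nth_deriv_Suc: "nth_deriv (Suc j) \<phi> = (\<lambda>x. vector_derivative (nth_deriv j \<phi>) (at x))"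
  by (simp add: nth_deriv_def)

text \<open>\<open>vector_derivative\<close> has an unspecified value where no derivative exists, so
  \<open>nth_deriv\<close> is awkward to compute directly. Exhibiting an explicit chain of
  derivatives determines it; the later computations of higher derivatives all do this.\<close>

lemma nth_deriv_eqI:
  assumes "deriv_seq F \<phi>"
  shows "nth_deriv j \<phi> = F j"
proof (induction j)
  case 0
  then show ?case using assms by (simp add: deriv_seq_def)
next
  case (Suc j)
  have "vector_derivative (F j) (at x) = F (Suc j) x" for x
    using assms by (intro vector_derivative_at) (simp add: deriv_seq_def)
  then show ?case by (simp add: nth_deriv_Suc Suc.IH)
qed

lemma SchwartzI:
  assumes F: "deriv_seq F \<phi>"
    and B: "\<And>k j. \<exists>B. \<forall>x. norm (of_real (x ^ k) * F j x) \<le> B"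
  shows "\<phi> \<in> Schwartz"
proof -
  have "F j differentiable at x" for j x
    using F unfolding deriv_seq_def by (meson differentiableI_vector)
  moreover have "bounded (range (\<lambda>x. of_real (x ^ k) * F j x))" for k j
    using B[of k j] by (auto simp: bounded_iff)
  ultimately show ?thesis
    by (simp add: Schwartz_def nth_deriv_eqI[OF F])
qed

lemma Schwartz_deriv_seq:
  assumes "\<phi> \<in> Schwartz"
  shows "deriv_seq (\<lambda>j. nth_deriv j \<phi>) \<phi>"
  using assms unfolding deriv_seq_def Schwartz_def
  by (auto simp: nth_deriv_Suc vector_derivative_works)

lemma Schwartz_bound:
  assumes "\<phi> \<in> Schwartz"
  obtains B where "\<And>x. norm (of_real (x ^ k) * nth_deriv j \<phi> x) \<le> B"
  using assms unfolding Schwartz_def bounded_iff by fast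

lemma Schwartz_seminorm_upper:
  assumes "\<phi> \<in> Schwartz"
  shows "norm (of_real (x ^ k) * nth_deriv j \<phi> x) \<le> Schwartz_seminorm k j \<phi>"
  unfolding Schwartz_seminorm_def
proof (rule cSUP_upper)
  obtain B where "\<And>x. norm (of_real (x ^ k) * nth_deriv j \<phi> x) \<le> B"
    using Schwartz_bound[OF assms] by blast
  then show "bdd_above (range (\<lambda>x. norm (of_real (x ^ k) * nth_deriv j \<phi> x)))"
    by (auto intro!: bdd_aboveI)
qed simp

lemma Schwartz_seminorm_least:
  assumes "\<And>x. norm (of_real (x ^ k) * nth_deriv j \<phi> x) \<le> B"
  shows "Schwartz_seminorm k j \<phi> \<le> B"
  unfolding Schwartz_seminorm_def using assms by (intro cSUP_least) auto

lemma deriv_seq_lincomb: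
  assumes "deriv_seq F \<phi>" "deriv_seq G \<psi>"
  shows "deriv_seq (\<lambda>j x. a * F j x + b * G j x) (\<lambda>x. a * \<phi> x + b * \<psi> x)"
  using assms unfolding deriv_seq_def
  by (auto intro!: has_vector_derivative_add has_vector_derivative_mult_right)

lemma Schwartz_lincomb:
  assumes "\<phi> \<in> Schwartz" "\<psi> \<in> Schwartz"
  shows "(\<lambda>x. a * \<phi> x + b * \<psi> x) \<in> Schwartz"
    and "nth_deriv j (\<lambda>x. a * \<phi> x + b * \<psi> x) = (\<lambda>x. a * nth_deriv j \<phi> x + b * nth_deriv j \<psi> x)"
proof -
  note D = deriv_seq_lincomb[OF assms[THEN Schwartz_deriv_seq], of a b]
  show "nth_deriv j (\<lambda>x. a * \<phi> x + b * \<psi> x) = (\<lambda>x. a * nth_deriv j \<phi> x + b * nth_deriv j \<psi> x)"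
    by (rule nth_deriv_eqI[OF D])
  show "(\<lambda>x. a * \<phi> x + b * \<psi> x) \<in> Schwartz"
  proof (rule SchwartzI[OF D])
    fix k j
    obtain B where B: "\<And>x. norm (of_real (x ^ k) * nth_deriv j \<phi> x) \<le> B"
      using Schwartz_bound[OF assms(1)] by blast
    obtain C where C: "\<And>x. norm (of_real (x ^ k) * nth_deriv j \<psi> x) \<le> C"
      using Schwartz_bound[OF assms(2)] by blast
    have "norm (of_real (x ^ k) * (a * nth_deriv j \<phi> x + b * nth_deriv j \<psi> x))
        \<le> norm a * B + norm b * C" for x
    proof -
      have "of_real (x ^ k) * (a * nth_deriv j \<phi> x + b * nth_deriv j \<psi> x)
        = a * (of_real (x ^ k) * nth_deriv j \<phi> x) + b * (of_real (x ^ k) * nth_deriv j \<psi> x)"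
        by (simp add: algebra_simps)
      then show ?thesis
        using norm_triangle_le[of "a * (of_real (x ^ k) * nth_deriv j \<phi> x)"
            "b * (of_real (x ^ k) * nth_deriv j \<psi> x)"]
          mult_left_mono[OF B[of x] norm_ge_zero[of a]] mult_left_mono[OF C[of x] norm_ge_zero[of b]]
        by (simp add: norm_mult)
    qed
    then show "\<exists>B. \<forall>x. norm (of_real (x ^ k) * (a * nth_deriv j \<phi> x + b * nth_deriv j \<psi> x)) \<le> B"
      by blast
  qed
qed

lemma Schwartz_zero: "(\<lambda>x. 0) \<in> Schwartz"
  by (rule SchwartzI[of "\<lambda>j x. 0"]) (auto simp: deriv_seq_def)

lemma Schwartz_add: "\<phi> \<in> Schwartz \<Longrightarrow> \<psi> \<in> Schwartz \<Longrightarrow> (\<lambda>x. \<phi> x + \<psi> x) \<in> Schwartz"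
  using Schwartz_lincomb(1)[of \<phi> \<psi> 1 1] by simp

lemma Schwartz_diff: "\<phi> \<in> Schwartz \<Longrightarrow> \<psi> \<in> Schwartz \<Longrightarrow> (\<lambda>x. \<phi> x - \<psi> x) \<in> Schwartz"
  using Schwartz_lincomb(1)[of \<phi> \<psi> 1 "-1"] by simp

lemma Schwartz_cmult: "\<phi> \<in> Schwartz \<Longrightarrow> (\<lambda>x. c * \<phi> x) \<in> Schwartz"
  using Schwartz_lincomb(1)[of \<phi> \<phi> c 0] by simp

lemma Schwartz_deriv:
  assumes "\<phi> \<in> Schwartz"
  shows "nth_deriv 1 \<phi> \<in> Schwartz"
proof (rule SchwartzI[of "\<lambda>j. nth_deriv (Suc j) \<phi>"])
  show "deriv_seq (\<lambda>j. nth_deriv (Suc j) \<phi>) (nth_deriv 1 \<phi>)"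
    using Schwartz_deriv_seq[OF assms] by (simp add: deriv_seq_def)
  show "\<exists>B. \<forall>x. norm (of_real (x ^ k) * nth_deriv (Suc j) \<phi> x) \<le> B" for k j
    using Schwartz_bound[OF assms] by blast
qed

lemma Schwartz_has_vector_derivative:
  assumes "\<phi> \<in> Schwartz"
  shows "(\<phi> has_vector_derivative nth_deriv 1 \<phi> x) (at x)"
  using Schwartz_deriv_seq[OF assms] by (auto simp: deriv_seq_def dest: spec[of _ 0])

lemma Schwartz_mult_id:
  assumes "\<phi> \<in> Schwartz"
  shows "(\<lambda>x. of_real x * \<phi> x) \<in> Schwartz"
proof -
  \<comment> \<open>Leibniz rule for x times \<phi>. At \<open>j = 0\<close> the truncated index
    \<open>j - 1\<close> carries the factor 0.\<close>
  let ?D = "\<lambda>j x. of_real x * nth_deriv j \<phi> x + of_nat j * nth_deriv (j - 1) \<phi> x"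
  have D: "(nth_deriv j \<phi> has_vector_derivative nth_deriv (Suc j) \<phi> x) (at x)" for j x
    using Schwartz_deriv_seq[OF assms] by (simp add: deriv_seq_def)
  have "deriv_seq ?D (\<lambda>x. of_real x * \<phi> x)"
    unfolding deriv_seq_def
  proof (intro conjI allI)
    fix j x
    have I: "((\<lambda>x. complex_of_real x) has_vector_derivative 1) (at x)"
      using has_vector_derivative_of_real[OF DERIV_ident[of "at x"]] by simp
    have "((\<lambda>x. of_nat j * nth_deriv (j - 1) \<phi> x)
        has_vector_derivative of_nat j * nth_deriv j \<phi> x) (at x)"
      by (cases j) (auto intro!: has_vector_derivative_mult_right D)
    from has_vector_derivative_add[OF has_vector_derivative_mult[OF I D] this]
    show "(?D j has_vector_derivative ?D (Suc j) x) (at x)"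
      by (rule has_vector_derivative_eq_rhs) (simp add: algebra_simps)
  qed simp
  then show ?thesis
  proof (rule SchwartzI)
    fix k j
    obtain B where B: "\<And>x. norm (of_real (x ^ Suc k) * nth_deriv j \<phi> x) \<le> B"
      using Schwartz_bound[OF assms] by blast
    obtain C where C: "\<And>x. norm (of_real (x ^ k) * nth_deriv (j - 1) \<phi> x) \<le> C"
      using Schwartz_bound[OF assms] by blast
    have "norm (of_real (x ^ k) * ?D j x) \<le> B + of_nat j * C" for x
    proof -
      have "of_real (x ^ k) * ?D j x = of_real (x ^ Suc k) * nth_deriv j \<phi> x
          + of_nat j * (of_real (x ^ k) * nth_deriv (j - 1) \<phi> x)"
        by (simp add: algebra_simps)
      then show ?thesis
        using norm_triangle_mono[OF B[of x], of "of_nat j * (of_real (x ^ k) * nth_deriv (j - 1) \<phi> x)"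
            "of_nat j * C"] mult_left_mono[OF C[of x], of "of_nat j"]
        by (simp add: norm_mult)
    qed
    then show "\<exists>B. \<forall>x. norm (of_real (x ^ k) * ?D j x) \<le> B" by blast
  qed
qed

lemma Schwartz_mult_power:
  "\<phi> \<in> Schwartz \<Longrightarrow> (\<lambda>x. of_real (x ^ k) * \<phi> x) \<in> Schwartz"
proof (induction k)
  case (Suc k)
  from Schwartz_mult_id[OF Suc.IH[OF Suc.prems]] show ?case by (simp add: mult.assoc)
qed simp

lemma Schwartz_continuous: "\<phi> \<in> Schwartz \<Longrightarrow> continuous_on A \<phi>"
  by (meson Schwartz_has_vector_derivative continuous_at_imp_continuous_on has_vector_derivative_continuous)

lemma Schwartz_measurable [measurable]: "\<phi> \<in> Schwartz \<Longrightarrow> \<phi> \<in> borel_measurable lborel"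
  using borel_measurable_continuous_onI[OF Schwartz_continuous] by simp

section \<open>Integrability of Schwartz functions and integration by parts\<close>

lemma integrable_inverse_1_plus_square: "integrable lborel (\<lambda>x::real. inverse (1 + x\<^sup>2))"
proof -
  have "set_integrable lborel (einterval (-\<infinity>) \<infinity>) (\<lambda>x::real. inverse (1 + x\<^sup>2))"
    by (rule interval_integral_FTC_nonneg(1)[of _ _ arctan _ "- (pi / 2)" "pi / 2"])
       (auto intro!: derivative_eq_intros continuous_intros tendsto_arctan_at_top tendsto_arctan_at_bot
          simp: at_top_def[symmetric] ereal_tendsto_simps add_nonneg_eq_0_iff
           field_simps power2_eq_square)
  then show ?thesis by (simp add: set_integrable_def)
qed

text \<open>Adding the bounds on \<phi> and on x^2 \<phi> gives one majorant that serves both for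
  integrability and for the limits at infinity.\<close>

lemma Schwartz_decay:
  assumes "\<phi> \<in> Schwartz"
  obtains B where "B \<ge> 0" "\<And>x. norm (\<phi> x) \<le> B * inverse (1 + x\<^sup>2)"
proof -
  obtain B where B: "\<And>x. norm (of_real (x ^ 0) * nth_deriv 0 \<phi> x) \<le> B"
    using Schwartz_bound[OF assms] by blast
  obtain C where C: "\<And>x. norm (of_real (x ^ 2) * nth_deriv 0 \<phi> x) \<le> C"
    using Schwartz_bound[OF assms] by blast
  have "norm (\<phi> x) * (1 + x\<^sup>2) \<le> B + C" for x
    using B[of x] C[of x] by (simp add: norm_mult norm_power algebra_simps)
  moreover have "1 + x\<^sup>2 > (0::real)" for x by (simp add: add_pos_nonneg)
  ultimately have "norm (\<phi> x) \<le> (B + C) * inverse (1 + x\<^sup>2)" for x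
    by (simp add: field_simps)
  moreover have "B + C \<ge> 0"
    using order_trans[OF norm_ge_zero B] order_trans[OF norm_ge_zero C] by simp
  ultimately show ?thesis using that by blast
qed

lemma Schwartz_integrable:
  assumes "\<phi> \<in> Schwartz"
  shows "integrable lborel \<phi>"
proof -
  obtain B where B: "B \<ge> 0" "\<And>x. norm (\<phi> x) \<le> B * inverse (1 + x\<^sup>2)"
    using Schwartz_decay[OF assms] by blast
  show ?thesis
  proof (rule Bochner_Integration.integrable_bound)
    show "integrable lborel (\<lambda>x. B * inverse (1 + x\<^sup>2))"
      using integrable_inverse_1_plus_square by simp
    show "\<phi> \<in> borel_measurable lborel" using assms by measurable
    show "AE x in lborel. norm (\<phi> x) \<le> norm (B * inverse (1 + x\<^sup>2))"
      using B by (intro AE_I2) (metis order_trans abs_ge_self real_norm_def)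
  qed
qed

lemma Schwartz_bounded:
  assumes "\<phi> \<in> Schwartz"
  obtains B where "B \<ge> 0" "\<And>x. norm (\<phi> x) \<le> B"
proof -
  obtain B where "\<And>x. norm (of_real (x ^ 0) * nth_deriv 0 \<phi> x) \<le> B"
    using Schwartz_bound[OF assms] by blast
  then show ?thesis using that[of B] order_trans[OF norm_ge_zero, of "\<phi> 0"] by auto
qed

lemma Schwartz_integrable_mult:
  assumes "\<phi> \<in> Schwartz" "\<psi> \<in> borel_measurable lborel" "\<And>x. norm (\<psi> x) \<le> B"
  shows "integrable lborel (\<lambda>x. \<phi> x * \<psi> x :: complex)"
proof (rule Bochner_Integration.integrable_bound)
  show "integrable lborel (\<lambda>x. B * norm (\<phi> x))"
    using Schwartz_integrable[OF assms(1)] by auto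
  show "(\<lambda>x. \<phi> x * \<psi> x) \<in> borel_measurable lborel" using assms by measurable
  have "norm (\<phi> x * \<psi> x) \<le> norm (B * norm (\<phi> x))" for x
    using mult_left_mono[OF assms(3)[of x] norm_ge_zero[of "\<phi> x"]]
    by (simp add: norm_mult abs_mult mult.commute)
       (metis abs_ge_self mult.commute mult_left_mono norm_ge_zero order_trans)
  then show "AE x in lborel. norm (\<phi> x * \<psi> x) \<le> norm (B * norm (\<phi> x))" by simp
qed

lemma Schwartz_integrable_Schwartz:
  assumes "\<phi> \<in> Schwartz" "\<psi> \<in> Schwartz"
  shows "integrable lborel (\<lambda>x. \<phi> x * \<psi> x)"
  using Schwartz_bounded[OF assms(2)] Schwartz_integrable_mult[OF assms(1)] Schwartz_measurable[OF assms(2)]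
  by metis

lemma Schwartz_tendsto_0:
  assumes "\<phi> \<in> Schwartz"
  shows "(\<phi> \<longlongrightarrow> 0) at_top" "(\<phi> \<longlongrightarrow> 0) at_bot"
proof -
  obtain B where B: "\<And>x. norm (\<phi> x) \<le> B * inverse (1 + x\<^sup>2)"
    using Schwartz_decay[OF assms] by blast
  have top: "((\<lambda>x. B * inverse (1 + x\<^sup>2)) \<longlongrightarrow> 0) at_top"
    by (rule tendsto_mult_right_zero, rule tendsto_inverse_0_at_top,
        rule filterlim_tendsto_add_at_top[OF tendsto_const], rule filterlim_pow_at_top[OF _ filterlim_ident]) simp
  moreover from top have "((\<lambda>x. B * inverse (1 + x\<^sup>2)) \<longlongrightarrow> 0) at_bot"
    by (simp add: filterlim_at_bot_mirror)
  ultimately show "(\<phi> \<longlongrightarrow> 0) at_top" "(\<phi> \<longlongrightarrow> 0) at_bot"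
    by (auto intro!: Lim_null_comparison[of \<phi>] always_eventually B)
qed

text \<open>The integral over [-n, n] is F(n) - F(-n), which tends to 0, and it tends to the
  integral over the line by dominated convergence.\<close>

lemma integral_deriv_vanishing:
  fixes F f :: "real \<Rightarrow> complex"
  assumes D: "\<And>x. (F has_vector_derivative f x) (at x)"
    and "continuous_on UNIV f" "integrable lborel f"
    and lim: "(F \<longlongrightarrow> 0) at_top" "(F \<longlongrightarrow> 0) at_bot"
  shows "(LINT x|lborel. f x) = 0"
proof -
  have "(\<lambda>n::nat. LINT x|lborel. indicator {- real n..real n} x *\<^sub>R f x) \<longlonglongrightarrow> (LINT x|lborel. f x)"
  proof (rule integral_dominated_convergence)
    show "integrable lborel (\<lambda>x. norm (f x))" using assms by auto
    show f: "f \<in> borel_measurable lborel" using assms by auto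
    show "(\<lambda>x. indicator {- real n..real n} x *\<^sub>R f x) \<in> borel_measurable lborel" for n
      using f by measurable
    show "AE x in lborel. norm (indicator {- real n..real n} x *\<^sub>R f x) \<le> norm (f x)" for n
      by (auto simp: indicator_def)
    have "(\<lambda>n. indicator {- real n..real n} x *\<^sub>R f x) \<longlonglongrightarrow> f x" for x
    proof (rule tendsto_eventually)
      obtain N where N: "\<bar>x\<bar> \<le> real N" using real_arch_simple by blast
      have "indicator {- real n..real n} x *\<^sub>R f x = f x" if "n \<ge> N" for n
        using N that by (auto simp: indicator_def)
      then show "\<forall>\<^sub>F n in sequentially. indicator {- real n..real n} x *\<^sub>R f x = f x"
        by (auto simp: eventually_sequentially)
    qed
    then show "AE x in lborel. (\<lambda>n. indicator {- real n..real n} x *\<^sub>R f x) \<longlonglongrightarrow> f x" by simp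
  qed
  moreover have "(LINT x|lborel. indicator {- real n..real n} x *\<^sub>R f x) = F (real n) - F (- real n)" for n :: nat
    using D assms(2) by (intro integral_FTC_Icc)
      (auto intro: has_vector_derivative_at_within continuous_on_subset)
  moreover have "(\<lambda>n. F (real n) - F (- real n)) \<longlonglongrightarrow> 0 - 0"
    by (intro tendsto_diff filterlim_compose[OF lim(1)] filterlim_compose[OF lim(2)]
      filterlim_real_sequentially filterlim_uminus_at_bot_at_top[THEN filterlim_compose])
  ultimately show ?thesis using LIMSEQ_unique by fastforce
qed

lemma Schwartz_integral_by_parts:
  assumes "\<phi> \<in> Schwartz" "\<psi> \<in> Schwartz"
  shows "(LINT x|lborel. nth_deriv 1 \<phi> x * \<psi> x) = - (LINT x|lborel. \<phi> x * nth_deriv 1 \<psi> x)"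
proof -
  note S = assms assms[THEN Schwartz_deriv]
  have "(LINT x|lborel. \<phi> x * nth_deriv 1 \<psi> x + nth_deriv 1 \<phi> x * \<psi> x) = 0"
  proof (rule integral_deriv_vanishing)
    show "((\<lambda>x. \<phi> x * \<psi> x) has_vector_derivative \<phi> x * nth_deriv 1 \<psi> x + nth_deriv 1 \<phi> x * \<psi> x) (at x)" for x
      using assms by (intro has_vector_derivative_mult Schwartz_has_vector_derivative)
    show "continuous_on UNIV (\<lambda>x. \<phi> x * nth_deriv 1 \<psi> x + nth_deriv 1 \<phi> x * \<psi> x)"
      by (intro continuous_intros Schwartz_continuous S)
    show "integrable lborel (\<lambda>x. \<phi> x * nth_deriv 1 \<psi> x + nth_deriv 1 \<phi> x * \<psi> x)"
      by (intro Bochner_Integration.integrable_add Schwartz_integrable_Schwartz S)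
    show "((\<lambda>x. \<phi> x * \<psi> x) \<longlongrightarrow> 0) at_top" "((\<lambda>x. \<phi> x * \<psi> x) \<longlongrightarrow> 0) at_bot"
      using tendsto_mult[OF Schwartz_tendsto_0(1)[OF assms(1)] Schwartz_tendsto_0(1)[OF assms(2)]]
        tendsto_mult[OF Schwartz_tendsto_0(2)[OF assms(1)] Schwartz_tendsto_0(2)[OF assms(2)]] by auto
  qed
  then show ?thesis
    by (subst (asm) Bochner_Integration.integral_add)
       (auto intro!: Schwartz_integrable_Schwartz S simp: eq_neg_iff_add_eq_0 add.commute simp del: One_nat_def)
qed

section \<open>Hermite functions\<close>

text \<open>The three-term recurrence of the physicists' Hermite polynomials, easier to handle than
  the iterated derivative in \<open>hermite_poly\<close>. In the step from \<open>n = 0\<close> the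
  truncated index \<open>n - 1\<close> comes with the factor 0.\<close>

fun hermite_rec :: "nat \<Rightarrow> real \<Rightarrow> real" where
  "hermite_rec 0 x = 1"
| "hermite_rec (Suc n) x = 2 * x * hermite_rec n x - 2 * real n * hermite_rec (n - 1) x"

lemma hermite_rec_deriv:
  "(hermite_rec n has_field_derivative 2 * real n * hermite_rec (n - 1) x) (at x)"
proof (induction n rule: less_induct)
  case (less n)
  show ?case
  proof (cases n)
    case 0
    have "hermite_rec 0 = (\<lambda>x. 1)" by auto
    then show ?thesis using 0 by simp
  next
    case (Suc m)
    have eq: "hermite_rec (Suc m) = (\<lambda>x. 2 * x * hermite_rec m x - 2 * real m * hermite_rec (m - 1) x)"
      by auto
    \<comment> \<open>Differentiating the recurrence gives \<open>2 * hermite_rec m x\<close> plus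
      \<open>2 * m\<close> times the recurrence for index \<open>m\<close> itself; the case split
      settles the truncated subtractions.\<close>
    have *: "2 * hermite_rec m x + 2 * x * (2 * real m * hermite_rec (m - 1) x)
        - 2 * real m * (2 * real (m - 1) * hermite_rec (m - 1 - 1) x) = 2 * real (Suc m) * hermite_rec m x"
      by (cases m) (auto simp: algebra_simps)
    show ?thesis
      unfolding Suc eq
      by (rule derivative_eq_intros less.IH refl | simp add: Suc)+ (use * in \<open>simp add: algebra_simps\<close>)
  qed
qed

text \<open>One more derivative replaces the factor h_n of the Gaussian by 2 n h_(n-1) - 2 t h_n,
  which is -h_(n+1) by the recurrence.\<close>

lemma deriv_gaussian:
  "(deriv ^^ n) (\<lambda>t. exp (- t\<^sup>2)) = (\<lambda>t. (-1) ^ n * hermite_rec n t * exp (- t\<^sup>2))"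
proof (induction n)
  case (Suc n)
  have "((\<lambda>t. (-1) ^ n * hermite_rec n t * exp (- t\<^sup>2)) has_field_derivative
      (-1) ^ Suc n * hermite_rec (Suc n) t * exp (- t\<^sup>2)) (at t)" for t
    by (rule derivative_eq_intros hermite_rec_deriv refl | simp)+ (simp add: algebra_simps)
  then show ?case by (auto simp: Suc.IH intro!: DERIV_imp_deriv)
qed simp

lemma hermite_poly_eq_rec: "hermite_poly n x = hermite_rec n x"
proof -
  have sgn: "(-1::real) ^ n * (-1) ^ n = 1"
    by (simp flip: power_add mult_2)
  have "hermite_poly n x = ((-1) ^ n * (-1) ^ n) * hermite_rec n x * (exp (x\<^sup>2) * exp (- x\<^sup>2))"
    by (simp only: hermite_poly_def deriv_gaussian mult_ac)
  then show ?thesis unfolding sgn by (simp flip: exp_add)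
qed

section \<open>Ladder relations of the normalised Hermite functions\<close>

definition hermite_const :: "nat \<Rightarrow> real" where
  "hermite_const n = pi powr (-1/4) * (2 ^ n * fact n) powr (-1/2)"

lemma hermite_fun_eq:
  "hermite_fun n x = of_real (hermite_const n * exp (- x\<^sup>2 / 2) * hermite_rec n x)"
  by (simp add: hermite_fun_def hermite_const_def hermite_poly_eq_rec)

lemma hermite_const_Suc: "hermite_const n = sqrt (2 * (real n + 1)) * hermite_const (Suc n)"
proof -
  have "(2 ^ Suc n * fact (Suc n)) powr (-1/2) = (2 * (real n + 1)) powr (-1/2) * (2 ^ n * fact n) powr (-1/2)"
    by (subst powr_mult[symmetric]) (auto simp: algebra_simps)
  moreover have "sqrt (2 * (real n + 1)) * (2 * (real n + 1)) powr (-1/2) = 1"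
    by (simp add: powr_minus powr_half_sqrt)
  ultimately show ?thesis
    unfolding hermite_const_def by (simp add: mult_ac)
qed

text \<open>With \<open>hermite_up\<close>, the off-diagonal entries of the Jacobi matrix of
  multiplication by x in the Hermite basis. Since \<open>hermite_down 0\<close> is 0, the truncated
  index \<open>n - 1\<close> does no harm at \<open>n = 0\<close>.\<close>

abbreviation (input) hermite_down :: "nat \<Rightarrow> complex" where
  "hermite_down n \<equiv> of_real (sqrt (real n / 2))"

abbreviation (input) hermite_up :: "nat \<Rightarrow> complex" where
  "hermite_up n \<equiv> of_real (sqrt ((real n + 1) / 2))"

lemma hermite_const_pred:
  "sqrt (real n / 2) * hermite_const (n - 1) = real n * hermite_const n"
proof (cases n)
  case (Suc m)
  have "sqrt (real n / 2) * sqrt (2 * (real m + 1)) = real n"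
    unfolding Suc real_sqrt_mult[symmetric] by (rule real_sqrt_unique) (simp_all add: power2_eq_square)
  then show ?thesis using Suc hermite_const_Suc[of m] by simp
qed simp

lemma hermite_const_succ:
  "sqrt ((real n + 1) / 2) * hermite_const (Suc n) = hermite_const n / 2"
proof -
  have "sqrt (2 * (real n + 1)) = 2 * sqrt ((real n + 1) / 2)"
    by (rule real_sqrt_unique) (simp_all add: power_mult_distrib)
  then show ?thesis using hermite_const_Suc[of n] by simp
qed

text \<open>This is x h_n = n h_(n-1) + h_(n+1) / 2; the normalising constants turn n and 1/2 into
  the two square roots.\<close>

lemma hermite_mult_id:
  "of_real x * hermite_fun n x
    = hermite_down n * hermite_fun (n - 1) x + hermite_up n * hermite_fun (Suc n) x"
proof -
  have "x * (hermite_const n * exp (- x\<^sup>2 / 2) * hermite_rec n x)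
    = (sqrt (real n / 2) * hermite_const (n - 1)) * exp (- x\<^sup>2 / 2) * hermite_rec (n - 1) x
    + (sqrt ((real n + 1) / 2) * hermite_const (Suc n)) * exp (- x\<^sup>2 / 2) * hermite_rec (Suc n) x"
    unfolding hermite_const_pred hermite_const_succ by (simp add: algebra_simps)
  then show ?thesis
    unfolding hermite_fun_eq of_real_mult[symmetric] of_real_add[symmetric] of_real_eq_iff
    by (simp only: mult.assoc)
qed

text \<open>The Gaussian factor contributes -x h_n and the polynomial 2 n h_(n-1), together n
  h_(n-1) - h_(n+1) / 2: the same terms as for multiplication by x, with one sign changed.\<close>

lemma hermite_has_vector_derivative:
  "(hermite_fun n has_vector_derivative
    hermite_down n * hermite_fun (n - 1) x - hermite_up n * hermite_fun (Suc n) x) (at x)"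
proof -
  let ?h = "\<lambda>n x. hermite_const n * exp (- x\<^sup>2 / 2) * hermite_rec n x"
  have "(?h n has_field_derivative
      sqrt (real n / 2) * ?h (n - 1) x - sqrt ((real n + 1) / 2) * ?h (Suc n) x) (at x)"
  proof (rule DERIV_cong)
    show "(?h n has_field_derivative hermite_const n * exp (- x\<^sup>2 / 2) * (- x) * hermite_rec n x
      + hermite_const n * exp (- x\<^sup>2 / 2) * (2 * real n * hermite_rec (n - 1) x)) (at x)"
      by (rule derivative_eq_intros hermite_rec_deriv refl | simp)+
    have "sqrt (real n / 2) * ?h (n - 1) x - sqrt ((real n + 1) / 2) * ?h (Suc n) x
      = (sqrt (real n / 2) * hermite_const (n - 1)) * exp (- x\<^sup>2 / 2) * hermite_rec (n - 1) x
      - (sqrt ((real n + 1) / 2) * hermite_const (Suc n)) * exp (- x\<^sup>2 / 2) * hermite_rec (Suc n) x"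
      by (simp only: mult.assoc)
    then show "hermite_const n * exp (- x\<^sup>2 / 2) * (- x) * hermite_rec n x
      + hermite_const n * exp (- x\<^sup>2 / 2) * (2 * real n * hermite_rec (n - 1) x)
      = sqrt (real n / 2) * ?h (n - 1) x - sqrt ((real n + 1) / 2) * ?h (Suc n) x"
      unfolding hermite_const_pred hermite_const_succ by (simp add: algebra_simps)
  qed
  from has_vector_derivative_of_real[OF this]
  show ?thesis by (simp add: hermite_fun_eq[abs_def])
qed

text \<open>Derivatives are kept as combinations of Hermite functions with neighbouring indices, so
  bounds for all \<open>j\<close> follow by induction from bounds on the functions themselves, for
  all \<open>n\<close> at once.\<close>

fun hermite_deriv :: "nat \<Rightarrow> nat \<Rightarrow> real \<Rightarrow> complex" where
  "hermite_deriv 0 n x = hermite_fun n x"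
| "hermite_deriv (Suc j) n x
    = hermite_down n * hermite_deriv j (n - 1) x - hermite_up n * hermite_deriv j (Suc n) x"

lemma deriv_seq_hermite: "deriv_seq (\<lambda>j. hermite_deriv j n) (hermite_fun n)"
proof -
  have "(hermite_deriv j n has_vector_derivative hermite_deriv (Suc j) n x) (at x)" for j x
  proof (induction j arbitrary: n)
    case 0
    show ?case using hermite_has_vector_derivative[of n x] by simp
  next
    case (Suc j)
    have "hermite_deriv (Suc j) n
      = (\<lambda>x. hermite_down n * hermite_deriv j (n - 1) x - hermite_up n * hermite_deriv j (Suc n) x)"
      by auto
    then show ?case
      by (simp only: hermite_deriv.simps(2)[of "Suc j"])
         (intro has_vector_derivative_diff has_vector_derivative_mult_right Suc.IH)
  qed
  then show ?thesis by (auto simp: deriv_seq_def)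
qed

text \<open>The k-th term of the exponential series of x^2 / 2 bounds x^(2k) exp (- x^2 / 2) by 2^k
  k!, and the k-th power of |x| is at most the 2k-th once |x| \<ge> 1.\<close>

lemma gaussian_power_bounded: "\<exists>B. \<forall>x::real. \<bar>x\<bar> ^ k * exp (- x\<^sup>2 / 2) \<le> B"
proof -
  have "\<bar>x\<bar> ^ k * exp (- x\<^sup>2 / 2) \<le> 1 + 2 ^ k * fact k" for x :: real
  proof (cases "\<bar>x\<bar> \<le> 1")
    case True
    then have "\<bar>x\<bar> ^ k * exp (- x\<^sup>2 / 2) \<le> 1 * 1"
      by (intro mult_mono power_le_one) auto
    then show ?thesis by (smt (verit) fact_gt_zero mult_pos_pos zero_less_power)
  next
    case False
    have "(x\<^sup>2 / 2) ^ k /\<^sub>R fact k \<le> (\<Sum>i. (x\<^sup>2 / 2) ^ i /\<^sub>R fact i)"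
      using sum_le_suminf[OF summable_exp_generic[of "x\<^sup>2 / 2"] finite.emptyI[THEN finite.insertI, of k]]
      by simp
    then have "(x\<^sup>2) ^ k \<le> 2 ^ k * fact k * exp (x\<^sup>2 / 2)"
      unfolding fun_cong[OF exp_def, symmetric] by (simp only: power_divide) (simp add: field_simps)
    then have "(x\<^sup>2) ^ k * exp (- x\<^sup>2 / 2) \<le> 2 ^ k * fact k"
      by (simp add: exp_minus field_simps)
    then have "(\<bar>x\<bar> ^ k) * (\<bar>x\<bar> ^ k) * exp (- x\<^sup>2 / 2) \<le> 2 ^ k * fact k"
      by (simp only: power_mult_distrib[symmetric] abs_mult_self_eq power2_eq_square)
    moreover have "\<bar>x\<bar> ^ k * 1 \<le> \<bar>x\<bar> ^ k * \<bar>x\<bar> ^ k"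
      using False by (intro mult_left_mono) auto
    then have "\<bar>x\<bar> ^ k * exp (- x\<^sup>2 / 2) \<le> (\<bar>x\<bar> ^ k) * (\<bar>x\<bar> ^ k) * exp (- x\<^sup>2 / 2)"
      by (intro mult_right_mono) auto
    ultimately show ?thesis by linarith
  qed
  then show ?thesis by blast
qed

text \<open>The recurrence trades the degree for one more factor x, hence the induction for
  arbitrary \<open>k\<close>.\<close>

lemma hermite_rec_gaussian_bounded:
  "\<exists>B. \<forall>x. \<bar>x\<bar> ^ k * \<bar>hermite_rec n x\<bar> * exp (- x\<^sup>2 / 2) \<le> B"
proof (induction n arbitrary: k rule: less_induct)
  case (less n)
  show ?case
  proof (cases n)
    case 0
    then show ?thesis using gaussian_power_bounded[of k] by simp
  next
    case (Suc m)
    obtain B where B: "\<And>x. \<bar>x\<bar> ^ Suc k * \<bar>hermite_rec m x\<bar> * exp (- x\<^sup>2 / 2) \<le> B"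
      using less.IH[of m "Suc k"] Suc by blast
    obtain C where C: "\<And>x. \<bar>x\<bar> ^ k * \<bar>hermite_rec (m - 1) x\<bar> * exp (- x\<^sup>2 / 2) \<le> C"
      using less.IH[of "m - 1" k] Suc by fastforce
    have "\<bar>x\<bar> ^ k * \<bar>hermite_rec n x\<bar> * exp (- x\<^sup>2 / 2) \<le> 2 * B + 2 * real m * C" for x
    proof -
      have "\<bar>hermite_rec n x\<bar> \<le> 2 * \<bar>x\<bar> * \<bar>hermite_rec m x\<bar> + 2 * real m * \<bar>hermite_rec (m - 1) x\<bar>"
        using Suc by (auto simp: abs_mult intro!: order_trans[OF abs_triangle_ineq4])
      then have "\<bar>x\<bar> ^ k * \<bar>hermite_rec n x\<bar> * exp (- x\<^sup>2 / 2)
        \<le> \<bar>x\<bar> ^ k * (2 * \<bar>x\<bar> * \<bar>hermite_rec m x\<bar> + 2 * real m * \<bar>hermite_rec (m - 1) x\<bar>) * exp (- x\<^sup>2 / 2)"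
        by (intro mult_right_mono mult_left_mono) auto
      also have "\<dots> = 2 * (\<bar>x\<bar> ^ Suc k * \<bar>hermite_rec m x\<bar> * exp (- x\<^sup>2 / 2))
          + 2 * real m * (\<bar>x\<bar> ^ k * \<bar>hermite_rec (m - 1) x\<bar> * exp (- x\<^sup>2 / 2))"
        by (simp add: algebra_simps)
      also have "\<dots> \<le> 2 * B + 2 * real m * C"
        by (intro add_mono mult_left_mono B C) auto
      finally show ?thesis .
    qed
    then show ?thesis by blast
  qed
qed

text \<open>The square roots are replaced by n + 1, as only polynomial growth matters. The minus
  sign is that of the derivative, the plus sign that of multiplication by x.\<close>

lemma norm_hermite_lincomb_le:
  assumes "norm u \<le> B" "norm v \<le> C"
  shows "norm (hermite_down n * u - hermite_up n * v) \<le> (real n + 1) * B + (real n + 1) * C"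
    and "norm (hermite_down n * u + hermite_up n * v) \<le> (real n + 1) * B + (real n + 1) * C"
proof -
  have "sqrt y \<le> real n + 1" if "0 \<le> y" "y \<le> real n + 1" for y
  proof (rule real_le_lsqrt)
    have "real n + 1 \<le> (real n + 1)\<^sup>2" by (rule self_le_power) auto
    then show "y \<le> (real n + 1)\<^sup>2" using that by linarith
  qed simp
  then have "norm (hermite_down n * u) \<le> (real n + 1) * B" "norm (hermite_up n * v) \<le> (real n + 1) * C"
    using assms by (simp_all add: norm_mult mult_mono)
  then show "norm (hermite_down n * u - hermite_up n * v) \<le> (real n + 1) * B + (real n + 1) * C"
    "norm (hermite_down n * u + hermite_up n * v) \<le> (real n + 1) * B + (real n + 1) * C"
    by (auto intro!: norm_triangle_le norm_triangle_le_diff)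
qed

lemma hermite_in_Schwartz: "hermite_fun n \<in> Schwartz"
proof (rule SchwartzI[OF deriv_seq_hermite])
  fix k j
  show "\<exists>B. \<forall>x. norm (of_real (x ^ k) * hermite_deriv j n x) \<le> B"
  proof (induction j arbitrary: n)
    case 0
    obtain B where B: "\<And>x. \<bar>x\<bar> ^ k * \<bar>hermite_rec n x\<bar> * exp (- x\<^sup>2 / 2) \<le> B"
      using hermite_rec_gaussian_bounded by blast
    have "norm (of_real (x ^ k) * hermite_deriv 0 n x) \<le> \<bar>hermite_const n\<bar> * B" for x
      using mult_left_mono[OF B[of x], of "\<bar>hermite_const n\<bar>"]
      by (simp add: hermite_fun_eq norm_mult norm_power abs_mult mult_ac)
    then show ?case by blast
  next
    case (Suc j)
    obtain B where B: "\<And>x. norm (of_real (x ^ k) * hermite_deriv j (n - 1) x) \<le> B"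
      using Suc.IH by blast
    obtain C where C: "\<And>x. norm (of_real (x ^ k) * hermite_deriv j (Suc n) x) \<le> C"
      using Suc.IH by blast
    have "norm (of_real (x ^ k) * hermite_deriv (Suc j) n x) \<le> (real n + 1) * B + (real n + 1) * C" for x
      using norm_hermite_lincomb_le(1)[OF B C] by (simp add: algebra_simps)
    then show ?case by blast
  qed
qed

lemma nth_deriv_hermite: "nth_deriv j (hermite_fun n) = hermite_deriv j n"
  by (rule nth_deriv_eqI[OF deriv_seq_hermite])

lemma nth_deriv_1_hermite:
  "nth_deriv 1 (hermite_fun n)
    = (\<lambda>x. hermite_down n * hermite_fun (n - 1) x - hermite_up n * hermite_fun (Suc n) x)"
  unfolding nth_deriv_hermite One_nat_def by (rule ext) (simp only: hermite_deriv.simps One_nat_def)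

text \<open>\<open>d/dx + x\<close> and \<open>x - d/dx\<close> are formally adjoint and lower, respectively raise, the index
  of a Hermite function.\<close>

lemma hermite_raise:
  "of_real x * hermite_fun n x - nth_deriv 1 (hermite_fun n) x
    = of_real (sqrt (2 * (real n + 1))) * hermite_fun (Suc n) x"
proof -
  have "sqrt (2 * (real n + 1)) = 2 * sqrt ((real n + 1) / 2)"
    by (rule real_sqrt_unique) (simp_all add: power_mult_distrib)
  then show ?thesis
    by (simp only: nth_deriv_1_hermite hermite_mult_id) simp
qed

lemma hermite_lower:
  "of_real x * hermite_fun n x + nth_deriv 1 (hermite_fun n) x
    = of_real (sqrt (2 * real n)) * hermite_fun (n - 1) x"
proof -
  have "sqrt (2 * real n) = 2 * sqrt (real n / 2)"
    by (rule real_sqrt_unique) (simp_all add: power_mult_distrib)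
  then show ?thesis
    by (simp only: nth_deriv_1_hermite hermite_mult_id) simp
qed

text \<open>Integration by parts moves the raising operator x - d/dx from the Hermite function to
  \<phi>, where it becomes x + d/dx. The factor of order sqrt n on the left is the source of the
  decay of the coefficients.\<close>

lemma hermite_coeff_raise:
  assumes "\<phi> \<in> Schwartz"
  shows "of_real (sqrt (2 * (real n + 1))) * hermite_coeff \<phi> (Suc n)
    = hermite_coeff (\<lambda>x. of_real x * \<phi> x + nth_deriv 1 \<phi> x) n"
proof -
  note S = assms Schwartz_mult_id[OF assms] Schwartz_deriv[OF assms] hermite_in_Schwartz[of n]
    Schwartz_deriv[OF hermite_in_Schwartz[of n]] Schwartz_mult_id[OF hermite_in_Schwartz[of n]]
  note I = Schwartz_integrable_Schwartz
  have "of_real (sqrt (2 * (real n + 1))) * hermite_coeff \<phi> (Suc n)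
    = (LINT x|lborel. \<phi> x * (of_real (sqrt (2 * (real n + 1))) * hermite_fun (Suc n) x))"
    unfolding hermite_coeff_def integral_mult_right_zero[symmetric] by (simp only: mult.left_commute)
  also have "\<dots> = (LINT x|lborel. (of_real x * \<phi> x) * hermite_fun n x - \<phi> x * nth_deriv 1 (hermite_fun n) x)"
    unfolding hermite_raise[symmetric] by (simp only: right_diff_distrib mult.assoc mult.left_commute)
  also have "\<dots> = (LINT x|lborel. (of_real x * \<phi> x) * hermite_fun n x)
      - (LINT x|lborel. \<phi> x * nth_deriv 1 (hermite_fun n) x)"
    by (intro Bochner_Integration.integral_diff I S)
  also have "\<dots> = (LINT x|lborel. (of_real x * \<phi> x) * hermite_fun n x)
      + (LINT x|lborel. nth_deriv 1 \<phi> x * hermite_fun n x)"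
    by (simp only: Schwartz_integral_by_parts[OF S(1,4)] diff_conv_add_uminus)
  also have "\<dots> = (LINT x|lborel. (of_real x * \<phi> x) * hermite_fun n x + nth_deriv 1 \<phi> x * hermite_fun n x)"
    by (intro Bochner_Integration.integral_add[symmetric] I S)
  finally show ?thesis by (simp only: hermite_coeff_def distrib_right)
qed

lemma hermite_coeff_cmult: "hermite_coeff (\<lambda>x. c * \<phi> x) n = c * hermite_coeff \<phi> n"
  unfolding hermite_coeff_def integral_mult_right_zero[symmetric] by (simp only: mult.assoc)

lemma gaussian_integral: "has_bochner_integral lborel (\<lambda>x::real. exp (- x\<^sup>2)) (sqrt pi)"
  using has_bochner_integral_even_function[OF gaussian_moment_0] by simp

text \<open>Raising one index moves the lowering operator to the other factor, so both indices drop
  together. At \<open>n = 0\<close> what is left is the Gaussian integral, or, by symmetry, a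
  pairing in which the lowered \<open>hermite_fun 0\<close> is 0.\<close>

lemma hermite_coeff_hermite: "hermite_coeff (hermite_fun m) n = (if m = n then 1 else 0)"
proof (induction n arbitrary: m)
  case 0
  show ?case
  proof (cases m)
    case 0
    have "hermite_const 0 * hermite_const 0 = pi powr (-1/2)"
      by (simp add: hermite_const_def flip: powr_add)
    also have "\<dots> * sqrt pi = 1"
      by (simp add: powr_minus powr_half_sqrt)
    finally have "hermite_const 0 * hermite_const 0 * sqrt pi = 1" .
    moreover have "hermite_fun 0 x * hermite_fun 0 x
        = of_real (hermite_const 0 * hermite_const 0 * exp (- x\<^sup>2))" for x
      by (simp add: hermite_fun_eq mult_ac flip: of_real_mult exp_add)
    then have "hermite_coeff (hermite_fun 0) 0 = of_real (hermite_const 0 * hermite_const 0 * sqrt pi)"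
      unfolding hermite_coeff_def
      using has_bochner_integral_integral_eq[OF gaussian_integral] by simp
    ultimately show ?thesis using 0 by simp
  next
    case (Suc k)
    have "hermite_coeff (hermite_fun 0) (Suc k) = 0"
      using hermite_coeff_raise[OF hermite_in_Schwartz, of k 0]
      by (simp add: hermite_lower[of _ 0, simplified] hermite_coeff_def)
    moreover have "hermite_coeff (hermite_fun m) 0 = hermite_coeff (hermite_fun 0) m"
      by (simp add: hermite_coeff_def mult.commute)
    ultimately show ?thesis using Suc by simp
  qed
next
  case (Suc n)
  have "of_real (sqrt (2 * (real n + 1))) * hermite_coeff (hermite_fun m) (Suc n)
      = of_real (sqrt (2 * real m)) * hermite_coeff (hermite_fun (m - 1)) n"
    by (simp only: hermite_coeff_raise[OF hermite_in_Schwartz] hermite_lower hermite_coeff_cmult)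
  then show ?case
    by (cases m) (auto simp: Suc.IH add.commute split: if_splits)
qed

section \<open>Hermite series\<close>

lemma le_one_plus_square: "t \<le> 1 + t\<^sup>2" for t :: real
  using zero_le_power2[of "t - 1 / 2"] by (simp add: power2_diff power_divide)

lemma hermite_square_integral:
  "has_bochner_integral lborel (\<lambda>x. (norm (hermite_fun n x))\<^sup>2) 1"
proof -
  have "has_bochner_integral lborel (\<lambda>x. hermite_fun n x * hermite_fun n x) 1"
    using hermite_coeff_hermite[of n n] unfolding has_bochner_integral_iff hermite_coeff_def
    by (auto intro: Schwartz_integrable_Schwartz hermite_in_Schwartz)
  from has_bochner_integral_bounded_linear[OF bounded_linear_Re this]
  show ?thesis
    unfolding hermite_fun_eq norm_of_real power2_abs of_real_mult[symmetric] Re_complex_of_real one_complex.sel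
    by (simp only: power2_eq_square)
qed

text \<open>The square of \<xi>_n at x is minus the integral of 2 \<xi>_n \<xi>_n' over [x,
  \<infinity>), and the integrand is at most the sum of the squares of \<xi>_n and \<xi>_n'. As
  \<xi>_n' combines two functions of L2 norm 1, the total is at most 1 + n + (n + 1).\<close>

lemma hermite_norm_bound: "(norm (hermite_fun n x))\<^sup>2 \<le> 2 * (real n + 1)"
proof -
  \<comment> \<open>Majorant of the derivative of the square. Its last two terms dominate the square
    of \<xi>_n' by (u + v)^2 \<le> 2 u^2 + 2 v^2, where the factor 2 cancels the halves under the
    square roots.\<close>
  define w where "w x = (norm (hermite_fun n x))\<^sup>2 + (real n * (norm (hermite_fun (n - 1) x))\<^sup>2
      + (real n + 1) * (norm (hermite_fun (Suc n) x))\<^sup>2)" for x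
  have w: "has_bochner_integral lborel w (1 + (real n * 1 + (real n + 1) * 1))"
    unfolding w_def by (intro has_bochner_integral_add has_bochner_integral_mult_right hermite_square_integral)
  define d where "d = nth_deriv 1 (hermite_fun n)"
  have D: "((\<lambda>x. hermite_fun n x * hermite_fun n x) has_vector_derivative
      hermite_fun n x * d x + d x * hermite_fun n x) (at x within A)" for x A
    unfolding d_def by (intro has_vector_derivative_mult
        has_vector_derivative_at_within[OF Schwartz_has_vector_derivative] hermite_in_Schwartz)
  have le: "norm (hermite_fun n x * d x + d x * hermite_fun n x) \<le> w x" for x
  proof -
    define u v where "u = sqrt (real n / 2) * norm (hermite_fun (n - 1) x)"
      and "v = sqrt ((real n + 1) / 2) * norm (hermite_fun (Suc n) x)"
    have "norm (d x) \<le> u + v"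
      unfolding d_def nth_deriv_1_hermite u_def v_def
      by (rule order_trans[OF norm_triangle_ineq4]) (simp add: norm_mult)
    then have "(norm (d x))\<^sup>2 \<le> (u + v)\<^sup>2" by (rule power_mono) simp
    also have "\<dots> \<le> 2 * u\<^sup>2 + 2 * v\<^sup>2"
      using zero_le_power2[of "u - v"] by (simp add: power2_sum power2_diff)
    also have "\<dots> = real n * (norm (hermite_fun (n - 1) x))\<^sup>2 + (real n + 1) * (norm (hermite_fun (Suc n) x))\<^sup>2"
      by (simp add: u_def v_def power_mult_distrib)
    finally have "(norm (hermite_fun n x))\<^sup>2 + (norm (d x))\<^sup>2 \<le> w x"
      by (simp add: w_def)
    moreover have "2 * (norm (hermite_fun n x) * norm (d x)) \<le> (norm (hermite_fun n x))\<^sup>2 + (norm (d x))\<^sup>2"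
      using zero_le_power2[of "norm (hermite_fun n x) - norm (d x)"] by (simp add: power2_diff)
    moreover have "norm (hermite_fun n x * d x + d x * hermite_fun n x)
        \<le> 2 * (norm (hermite_fun n x) * norm (d x))"
      by (rule order_trans[OF norm_triangle_ineq]) (simp add: norm_mult)
    ultimately show ?thesis by linarith
  qed
  have main: "norm (hermite_fun n x * hermite_fun n x) - norm (hermite_fun n y * hermite_fun n y)
      \<le> 2 * (real n + 1)" if "x \<le> y" for y
  proof -
    have cont: "continuous_on A (\<lambda>x. hermite_fun n x * d x + d x * hermite_fun n x)" for A
      unfolding d_def
      by (intro continuous_intros Schwartz_continuous Schwartz_deriv hermite_in_Schwartz)
    note F = has_bochner_integral_FTC_Icc[OF that D cont]
    have "norm (hermite_fun n y * hermite_fun n y - hermite_fun n x * hermite_fun n x)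
      = norm (LINT t|lborel. indicator {x..y} t *\<^sub>R (hermite_fun n t * d t + d t * hermite_fun n t))"
      using has_bochner_integral_integral_eq[OF F] by simp
    also have "\<dots> \<le> (LINT t|lborel. w t)"
    proof (rule Bochner_Integration.integral_norm_bound_integral)
      show "norm (indicator {x..y} t *\<^sub>R (hermite_fun n t * d t + d t * hermite_fun n t)) \<le> w t" for t
        using le[of t] order_trans[OF norm_ge_zero le[of t]] by (simp add: indicator_def)
    qed (use F w in \<open>auto simp: has_bochner_integral_iff\<close>)
    also have "\<dots> = 2 * (real n + 1)"
      using has_bochner_integral_integral_eq[OF w] by simp
    finally show ?thesis
      using norm_triangle_ineq2[of "hermite_fun n x * hermite_fun n x" "hermite_fun n y * hermite_fun n y"]
      by (simp add: norm_minus_commute)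
  qed
  \<comment> \<open>Letting y tend to infinity removes the boundary term at y.\<close>
  have "((\<lambda>y. norm (hermite_fun n x * hermite_fun n x) - norm (hermite_fun n y * hermite_fun n y))
      \<longlongrightarrow> norm (hermite_fun n x * hermite_fun n x) - norm (0 * 0 :: complex)) at_top"
    by (intro tendsto_intros Schwartz_tendsto_0 hermite_in_Schwartz)
  moreover have "\<forall>\<^sub>F y in at_top. norm (hermite_fun n x * hermite_fun n x)
      - norm (hermite_fun n y * hermite_fun n y) \<le> 2 * (real n + 1)"
    using eventually_ge_at_top[of x] by eventually_elim (rule main)
  ultimately have "norm (hermite_fun n x * hermite_fun n x) - norm (0 * 0 :: complex) \<le> 2 * (real n + 1)"
    by (rule tendsto_upperbound) simp
  then show ?thesis by (simp add: norm_mult power2_eq_square)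
qed

text \<open>The neighbours of n have index at most n + 1, and n + 2 \<le> 2 (n + 1) costs the factor
  2^M; adding two terms costs another 2.\<close>

lemma hermite_lincomb_poly_bound:
  assumes "\<And>n. norm (u n) \<le> C * (real n + 1) ^ M"
  shows "norm (hermite_down n * u (n - 1) - hermite_up n * u (Suc n))
      \<le> (2 ^ Suc M * C) * (real n + 1) ^ Suc M"
    and "norm (hermite_down n * u (n - 1) + hermite_up n * u (Suc n))
      \<le> (2 ^ Suc M * C) * (real n + 1) ^ Suc M"
proof -
  have C: "C \<ge> 0" using order_trans[OF norm_ge_zero assms[of 0]] by simp
  have *: "norm (u k) \<le> C * (2 ^ M * (real n + 1) ^ M)" if "k \<le> Suc n" for k
  proof -
    have "(real k + 1) ^ M \<le> (2 * (real n + 1)) ^ M"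
      using that by (intro power_mono) auto
    then show ?thesis
      by (intro order_trans[OF assms mult_left_mono[OF _ C]]) (simp only: power_mult_distrib)
  qed
  have "norm (u (n - 1)) \<le> C * (2 ^ M * (real n + 1) ^ M)" "norm (u (Suc n)) \<le> C * (2 ^ M * (real n + 1) ^ M)"
    by (auto intro: *)
  from norm_hermite_lincomb_le[OF this]
  show "norm (hermite_down n * u (n - 1) - hermite_up n * u (Suc n)) \<le> (2 ^ Suc M * C) * (real n + 1) ^ Suc M"
    "norm (hermite_down n * u (n - 1) + hermite_up n * u (Suc n)) \<le> (2 ^ Suc M * C) * (real n + 1) ^ Suc M"
    by (simp_all add: mult_ac)
qed

text \<open>Multiplication by x (inner induction on \<open>k\<close>, at \<open>j = 0\<close>) and
  differentiation (outer induction on \<open>j\<close>) both combine neighbouring indices, so each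
  raises the degree \<open>M\<close> by one and keeps the bound uniform in x.\<close>

lemma hermite_deriv_poly_bound:
  "\<exists>C M. \<forall>n x. norm (of_real (x ^ k) * hermite_deriv j n x) \<le> C * (real n + 1) ^ M"
proof (induction j)
  case 0
  show ?case
  proof (induction k)
    case 0
    have "norm (hermite_fun n x) \<le> 3 * (real n + 1) ^ 1" for n x
    proof -
      have "norm (hermite_fun n x) \<le> 1 + (norm (hermite_fun n x))\<^sup>2"
        by (rule le_one_plus_square)
      then show ?thesis using hermite_norm_bound[of n x] by simp
    qed
    then show ?case by (intro exI[of _ 3] exI[of _ 1]) simp
  next
    case (Suc k)
    then obtain C M where CM: "\<And>n x. norm (of_real (x ^ k) * hermite_deriv 0 n x) \<le> C * (real n + 1) ^ M"
      by blast
    have "of_real (x ^ Suc k) * hermite_deriv 0 n x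
        = hermite_down n * (of_real (x ^ k) * hermite_deriv 0 (n - 1) x)
        + hermite_up n * (of_real (x ^ k) * hermite_deriv 0 (Suc n) x)" for n x
      using arg_cong[OF hermite_mult_id[of x n], of "\<lambda>y. of_real (x ^ k) * y"]
      by (simp only: hermite_deriv.simps power_Suc of_real_mult distrib_left mult_ac)
    then have "norm (of_real (x ^ Suc k) * hermite_deriv 0 n x) \<le> (2 ^ Suc M * C) * (real n + 1) ^ Suc M" for n x
      using hermite_lincomb_poly_bound(2)[of "\<lambda>n. of_real (x ^ k) * hermite_deriv 0 n x", OF CM] by metis
    then show ?case by blast
  qed
next
  case (Suc j)
  then obtain C M where CM: "\<And>n x. norm (of_real (x ^ k) * hermite_deriv j n x) \<le> C * (real n + 1) ^ M"
    by blast
  have "of_real (x ^ k) * hermite_deriv (Suc j) n x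
      = hermite_down n * (of_real (x ^ k) * hermite_deriv j (n - 1) x)
      - hermite_up n * (of_real (x ^ k) * hermite_deriv j (Suc n) x)" for n x
    by (simp add: algebra_simps)
  then have "norm (of_real (x ^ k) * hermite_deriv (Suc j) n x) \<le> (2 ^ Suc M * C) * (real n + 1) ^ Suc M" for n x
    using hermite_lincomb_poly_bound(1)[of "\<lambda>n. of_real (x ^ k) * hermite_deriv j n x", OF CM] by metis
  then show ?case by blast
qed

section \<open>Convergence of Hermite series in the Schwartz space\<close>

definition rapidly_decreasing :: "(nat \<Rightarrow> complex) \<Rightarrow> bool" where
  "rapidly_decreasing f \<longleftrightarrow> (\<forall>m. \<exists>K. \<forall>n. norm (f n) * (real n + 1) ^ m \<le> K)"

definition hermite_series :: "(nat \<Rightarrow> complex) \<Rightarrow> real \<Rightarrow> complex" where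
  "hermite_series f x = (\<Sum>n. f n * hermite_fun n x)"

text \<open>The Weierstrass test makes the series of derivatives converge uniformly; in one variable
  this is the operator-norm estimate that \<open>has_derivative_series\<close> asks for.\<close>

lemma has_vector_derivative_series:
  fixes f :: "nat \<Rightarrow> real \<Rightarrow> 'a::banach"
  assumes D: "\<And>n x. (f n has_vector_derivative f' n x) (at x)"
    and b: "\<And>n x. norm (f' n x) \<le> b n" "summable b"
    and f: "\<And>x. summable (\<lambda>n. f n x)"
  shows "((\<lambda>x. \<Sum>n. f n x) has_vector_derivative (\<Sum>n. f' n x)) (at x)"
proof -
  have U: "uniform_limit UNIV (\<lambda>n x. \<Sum>i<n. f' i x) (\<lambda>x. \<Sum>i. f' i x) sequentially"
    using b by (intro Weierstrass_m_test) auto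
  have "\<exists>g. \<forall>x\<in>UNIV. (\<lambda>n. f n x) sums g x \<and> (g has_derivative (\<lambda>h. h *\<^sub>R (\<Sum>n. f' n x))) (at x within UNIV)"
  proof (rule has_derivative_series)
    show "(f n has_derivative (\<lambda>h. h *\<^sub>R f' n x)) (at x within UNIV)" for n x
      using D[of n x] by (simp add: has_vector_derivative_def)
    show "\<forall>\<^sub>F n in sequentially. \<forall>x\<in>UNIV. \<forall>h.
      norm ((\<Sum>i<n. h *\<^sub>R f' i x) - h *\<^sub>R (\<Sum>n. f' n x)) \<le> e * norm h" if "e > 0" for e
      using uniform_limitD[OF U that]
    proof eventually_elim
      case (elim n)
      have "norm ((\<Sum>i<n. h *\<^sub>R f' i x) - h *\<^sub>R (\<Sum>n. f' n x))
          = norm h * dist (\<Sum>i<n. f' i x) (\<Sum>n. f' n x)" for x h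
        by (simp add: dist_norm flip: scaleR_right.sum scaleR_diff_right)
      moreover have "norm h * dist (\<Sum>i<n. f' i x) (\<Sum>n. f' n x) \<le> e * norm h" for x h
        using elim by (subst mult.commute) (intro mult_right_mono, auto intro: less_imp_le)
      ultimately show ?case by (simp only:) blast
    qed
    show "(\<lambda>n. f n x) sums (\<Sum>n. f n x)" using f by (rule summable_sums)
  qed auto
  then obtain g where g: "\<And>x. (\<lambda>n. f n x) sums g x"
    "\<And>x. (g has_derivative (\<lambda>h. h *\<^sub>R (\<Sum>n. f' n x))) (at x)" by auto
  have "g = (\<lambda>x. \<Sum>n. f n x)" using g(1) by (auto simp: sums_iff)
  then show ?thesis using g(2)[of x] by (simp add: has_vector_derivative_def)
qed

lemma rapidly_decreasing_summable_bound:
  assumes "rapidly_decreasing f"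
  obtains b where "summable b" "\<And>n x. norm (f n * (of_real (x ^ k) * hermite_deriv j n x)) \<le> b n"
proof -
  obtain C M where CM: "\<And>n x. norm (of_real (x ^ k) * hermite_deriv j n x) \<le> C * (real n + 1) ^ M"
    using hermite_deriv_poly_bound by blast
  \<comment> \<open>\<open>M\<close> powers cancel the growth of the Hermite functions, and two more
    leave the summable 1 / (n + 1)^2.\<close>
  obtain K where K: "\<And>n. norm (f n) * (real n + 1) ^ (M + 2) \<le> K"
    using assms unfolding rapidly_decreasing_def by blast
  have C: "C \<ge> 0" using order_trans[OF norm_ge_zero CM[of 0 0]] by simp
  have "norm (f n * (of_real (x ^ k) * hermite_deriv j n x)) \<le> C * K * inverse ((real (Suc n)) ^ 2)" for n x
  proof -
    have "norm (f n * (of_real (x ^ k) * hermite_deriv j n x)) \<le> norm (f n) * (C * (real n + 1) ^ M)"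
      unfolding norm_mult[of "f n"] by (intro mult_left_mono CM) auto
    also have "\<dots> = C * (norm (f n) * (real n + 1) ^ (M + 2)) * inverse ((real (Suc n)) ^ 2)"
    proof -
      have "(real n + 1) ^ 2 * inverse ((real (Suc n)) ^ 2) = 1"
        unfolding of_nat_Suc[of n] add.commute[of 1] by (rule right_inverse) simp
      then show ?thesis by (simp only: power_add mult.assoc mult_1_right mult.left_commute)
    qed
    also have "\<dots> \<le> C * K * inverse ((real (Suc n)) ^ 2)"
      by (intro mult_right_mono mult_left_mono K C) auto
    finally show ?thesis .
  qed
  moreover have "summable (\<lambda>n. C * K * inverse ((real (Suc n)) ^ 2))"
    using inverse_power_summable[of 2, where 'a=real]
    by (intro summable_mult) (subst summable_Suc_iff, simp)
  ultimately show ?thesis using that by blast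
qed

lemma hermite_series_summable:
  assumes "rapidly_decreasing f"
  shows "summable (\<lambda>n. f n * hermite_deriv j n x)"
proof -
  obtain b where b: "summable b" "\<And>n x. norm (f n * (of_real (x ^ 0) * hermite_deriv j n x)) \<le> b n"
    using rapidly_decreasing_summable_bound[OF assms] by blast
  show ?thesis
    by (rule summable_comparison_test'[OF b(1)]) (use b(2) in \<open>simp only: power_0 of_real_1 mult_1\<close>)
qed

lemma hermite_series_sums:
  "rapidly_decreasing f \<Longrightarrow> (\<lambda>n. f n * hermite_fun n x) sums hermite_series f x"
  using summable_sums[OF hermite_series_summable[of f 0 x]] by (simp add: hermite_series_def)

lemma deriv_seq_hermite_series:
  assumes "rapidly_decreasing f"
  shows "deriv_seq (\<lambda>j x. \<Sum>n. f n * hermite_deriv j n x) (hermite_series f)"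
  unfolding deriv_seq_def
proof (intro conjI allI)
  show "(\<lambda>x. \<Sum>n. f n * hermite_deriv 0 n x) = hermite_series f"
    by (auto simp: hermite_series_def)
  fix j x
  obtain b where b: "summable b" "\<And>n x. norm (f n * (of_real (x ^ 0) * hermite_deriv (Suc j) n x)) \<le> b n"
    using rapidly_decreasing_summable_bound[OF assms] by blast
  show "((\<lambda>x. \<Sum>n. f n * hermite_deriv j n x) has_vector_derivative (\<Sum>n. f n * hermite_deriv (Suc j) n x)) (at x)"
  proof (rule has_vector_derivative_series)
    show "((\<lambda>x. f n * hermite_deriv j n x) has_vector_derivative f n * hermite_deriv (Suc j) n x) (at x)" for n x
      using deriv_seq_hermite[of n] unfolding deriv_seq_def
      by (blast intro: has_vector_derivative_mult_right)
    show "norm (f n * hermite_deriv (Suc j) n x) \<le> b n" for n x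
      using b(2)[of n x] by (simp only: power_0 of_real_1 mult_1)
  qed (use b hermite_series_summable[OF assms] in auto)
qed

lemma hermite_series_weighted_bound:
  assumes "rapidly_decreasing f" "summable b"
    and b: "\<And>n x. norm (f n * (of_real (x ^ k) * hermite_deriv j n x)) \<le> b n"
  shows "norm (of_real (x ^ k) * (\<Sum>n. f n * hermite_deriv j n x)) \<le> (\<Sum>n. b n)"
proof -
  have "of_real (x ^ k) * (\<Sum>n. f n * hermite_deriv j n x)
      = (\<Sum>n. f n * (of_real (x ^ k) * hermite_deriv j n x))"
    by (subst suminf_mult[symmetric, OF hermite_series_summable[OF assms(1)]]) (simp only: mult.left_commute)
  moreover have s: "summable (\<lambda>n. norm (f n * (of_real (x ^ k) * hermite_deriv j n x)))"
    by (rule summable_comparison_test'[OF assms(2), of 0]) (use b in simp)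
  moreover have "(\<Sum>n. norm (f n * (of_real (x ^ k) * hermite_deriv j n x))) \<le> (\<Sum>n. b n)"
    by (rule suminf_le[OF b s assms(2)])
  ultimately show ?thesis using summable_norm[OF s] by (simp only:)
qed

lemma hermite_series_in_Schwartz:
  assumes "rapidly_decreasing f"
  shows "hermite_series f \<in> Schwartz"
proof (rule SchwartzI[OF deriv_seq_hermite_series[OF assms]])
  fix k j
  obtain b where "summable b" "\<And>n x. norm (f n * (of_real (x ^ k) * hermite_deriv j n x)) \<le> b n"
    using rapidly_decreasing_summable_bound[OF assms] by blast
  from hermite_series_weighted_bound[OF assms this]
  show "\<exists>B. \<forall>x. norm (of_real (x ^ k) * (\<Sum>n. f n * hermite_deriv j n x)) \<le> B" by blast
qed

lemma Schwartz_seminorm_hermite_series_le: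
  assumes "rapidly_decreasing f" "summable b"
    and "\<And>n x. norm (f n * (of_real (x ^ k) * hermite_deriv j n x)) \<le> b n"
  shows "Schwartz_seminorm k j (hermite_series f) \<le> (\<Sum>n. b n)"
  using hermite_series_weighted_bound[OF assms]
  by (intro Schwartz_seminorm_least) (simp only: nth_deriv_eqI[OF deriv_seq_hermite_series[OF assms(1)]])

lemma rapidly_decreasing_mono:
  assumes "rapidly_decreasing f" "\<And>n. norm (g n) \<le> norm (f n)"
  shows "rapidly_decreasing g"
  unfolding rapidly_decreasing_def
proof
  fix m
  obtain K where "\<And>n. norm (f n) * (real n + 1) ^ m \<le> K"
    using assms(1) unfolding rapidly_decreasing_def by blast
  then have "norm (g n) * (real n + 1) ^ m \<le> K" for n
    by (intro order_trans[OF mult_right_mono[OF assms(2)]]) auto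
  then show "\<exists>K. \<forall>n. norm (g n) * (real n + 1) ^ m \<le> K" by blast
qed

text \<open>The tail is a Hermite series with its first \<open>N\<close> coefficients set to 0, not
  one with shifted index, so that all facts about \<open>hermite_series\<close> apply to it.\<close>

lemma hermite_series_split:
  assumes "rapidly_decreasing f"
  shows "hermite_series f x = (\<Sum>n<N. f n * hermite_fun n x)
    + hermite_series (\<lambda>n. if n < N then 0 else f n) x"
proof -
  have "rapidly_decreasing (\<lambda>n. if n < N then 0 else f n)"
    using assms by (rule rapidly_decreasing_mono) auto
  from hermite_series_sums[OF this] have "(\<lambda>n. (if n \<in> {..<N} then f n * hermite_fun n x else 0)
        + (if n < N then 0 else f n) * hermite_fun n x)
      sums ((\<Sum>n<N. f n * hermite_fun n x) + hermite_series (\<lambda>n. if n < N then 0 else f n) x)"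
    by (intro sums_add sums_If_finite_set) auto
  moreover have "(\<lambda>n. (if n \<in> {..<N} then f n * hermite_fun n x else 0)
        + (if n < N then 0 else f n) * hermite_fun n x) = (\<lambda>n. f n * hermite_fun n x)"
    by auto
  ultimately show ?thesis
    by (intro sums_unique2[OF hermite_series_sums[OF assms]]) (simp only:)
qed

text \<open>The seminorm of the tail is at most the tail of the summable majorant.\<close>

lemma hermite_series_tail_tendsto_0:
  assumes "rapidly_decreasing f"
  shows "(\<lambda>N. Schwartz_seminorm k j (hermite_series (\<lambda>n. if n < N then 0 else f n))) \<longlonglongrightarrow> 0"
proof -
  obtain b where b: "summable b" "\<And>n x. norm (f n * (of_real (x ^ k) * hermite_deriv j n x)) \<le> b n"
    using rapidly_decreasing_summable_bound[OF assms] by blast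
  have "Schwartz_seminorm k j (hermite_series (\<lambda>n. if n < N then 0 else f n)) \<le> (\<Sum>n. b (n + N))"
    and "0 \<le> Schwartz_seminorm k j (hermite_series (\<lambda>n. if n < N then 0 else f n))" for N
  proof -
    let ?g = "\<lambda>n. if n < N then 0 else f n" and ?b = "\<lambda>n. if n < N then 0 else b n"
    have g: "rapidly_decreasing ?g"
      using assms by (rule rapidly_decreasing_mono) auto
    have s: "summable ?b"
      by (rule summable_cong[THEN iffD1, OF _ b(1)]) (auto simp: eventually_sequentially intro: exI[of _ N])
    have "Schwartz_seminorm k j (hermite_series ?g) \<le> (\<Sum>n. ?b n)"
      using b(2) by (intro Schwartz_seminorm_hermite_series_le g s) auto
    also have "\<dots> = (\<Sum>n. ?b (n + N)) + (\<Sum>n<N. ?b n)"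
      by (rule suminf_split_initial_segment[OF s])
    finally show "Schwartz_seminorm k j (hermite_series ?g) \<le> (\<Sum>n. b (n + N))" by simp
    show "0 \<le> Schwartz_seminorm k j (hermite_series ?g)"
      by (rule order_trans[OF norm_ge_zero Schwartz_seminorm_upper[OF hermite_series_in_Schwartz[OF g]]])
  qed
  note le = this
  show ?thesis
    by (rule tendsto_sandwich[OF _ _ tendsto_const suminf_exist_split2[OF b(1)]])
       (rule always_eventually, rule allI, rule le)+
qed

text \<open>The partial sums are bounded uniformly in x, so a constant times |\<xi>_m| dominates the
  products and the integral may be taken termwise.\<close>

lemma hermite_coeff_hermite_series:
  assumes "rapidly_decreasing f"
  shows "hermite_coeff (hermite_series f) m = f m"
proof -
  obtain b where b0: "summable b" "\<And>n x. norm (f n * (of_real (x ^ 0) * hermite_deriv 0 n x)) \<le> b n"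
    using rapidly_decreasing_summable_bound[OF assms] by blast
  then have b: "norm (f n * hermite_fun n x) \<le> b n" for n x using b0(2)[of n x] by simp
  have b_nonneg: "b n \<ge> 0" for n using order_trans[OF norm_ge_zero b] .
  note S = hermite_in_Schwartz
  have "(\<lambda>N. LINT x|lborel. (\<Sum>n<N. f n * hermite_fun n x) * hermite_fun m x)
      \<longlonglongrightarrow> (LINT x|lborel. hermite_series f x * hermite_fun m x)"
  proof (rule integral_dominated_convergence)
    show "(\<lambda>x. hermite_series f x * hermite_fun m x) \<in> borel_measurable lborel"
      using S hermite_series_in_Schwartz[OF assms] by measurable
    show "(\<lambda>x. (\<Sum>n<N. f n * hermite_fun n x) * hermite_fun m x) \<in> borel_measurable lborel" for N
      using S by measurable
    show "integrable lborel (\<lambda>x. (\<Sum>n. b n) * norm (hermite_fun m x))"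
      using Schwartz_integrable[OF S] by auto
    show "AE x in lborel. (\<lambda>N. (\<Sum>n<N. f n * hermite_fun n x) * hermite_fun m x)
        \<longlonglongrightarrow> hermite_series f x * hermite_fun m x"
      using hermite_series_sums[OF assms] unfolding sums_def by (intro AE_I2 tendsto_mult_right)
    have "norm ((\<Sum>n<N. f n * hermite_fun n x) * hermite_fun m x)
        \<le> (\<Sum>n. b n) * norm (hermite_fun m x)" for N x
    proof -
      have "norm (\<Sum>n<N. f n * hermite_fun n x) \<le> (\<Sum>n<N. b n)"
        by (intro sum_norm_le b)
      also have "\<dots> \<le> (\<Sum>n. b n)" using b0 b_nonneg by (intro sum_le_suminf) auto
      finally show ?thesis by (simp add: norm_mult mult_right_mono)
    qed
    then show "AE x in lborel. norm ((\<Sum>n<N. f n * hermite_fun n x) * hermite_fun m x)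
        \<le> (\<Sum>n. b n) * norm (hermite_fun m x)" for N by simp
  qed
  moreover have "(LINT x|lborel. (\<Sum>n<N. f n * hermite_fun n x) * hermite_fun m x)
      = (\<Sum>n<N. f n * hermite_coeff (hermite_fun n) m)" for N
    unfolding sum_distrib_right mult.assoc hermite_coeff_def
    by (subst Bochner_Integration.integral_sum)
       (simp_all add: Schwartz_integrable_Schwartz S)
  then have "(LINT x|lborel. (\<Sum>n<N. f n * hermite_fun n x) * hermite_fun m x) = f m" if "N > m" for N
    using that by (simp add: hermite_coeff_hermite if_distrib cong: if_cong)
  then have "(\<lambda>N. LINT x|lborel. (\<Sum>n<N. f n * hermite_fun n x) * hermite_fun m x) \<longlonglongrightarrow> f m"
    by (intro tendsto_eventually) (auto simp: eventually_sequentially intro: exI[of _ "Suc m"])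
  ultimately show ?thesis
    unfolding hermite_coeff_def using LIMSEQ_unique by blast
qed

section \<open>Decay of the Hermite coefficients of Schwartz functions\<close>

lemma Schwartz_coeff_decay:
  assumes "\<phi> \<in> Schwartz"
  shows "\<exists>K. \<forall>n. (norm (hermite_coeff \<phi> n))\<^sup>2 * (real n + 1) ^ m \<le> K"
  using assms
proof (induction m arbitrary: \<phi>)
  case 0
  note I = integrable_norm[OF Schwartz_integrable_Schwartz[OF 0 0]]
  have "norm (hermite_coeff \<phi> n) \<le> (LINT x|lborel. norm (\<phi> x * \<phi> x)) + 1" for n
  proof -
    have J: "integrable lborel (\<lambda>x. (norm (hermite_fun n x))\<^sup>2)"
      "(LINT x|lborel. (norm (hermite_fun n x))\<^sup>2) = 1"
      using hermite_square_integral[of n] by (simp_all only: has_bochner_integral_iff)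
    have "norm (hermite_coeff \<phi> n) \<le> (LINT x|lborel. norm (\<phi> x * \<phi> x) + (norm (hermite_fun n x))\<^sup>2)"
      unfolding hermite_coeff_def
    proof (rule Bochner_Integration.integral_norm_bound_integral)
      \<comment> \<open>An AM-GM bound takes the place of Cauchy-Schwarz: only a bound independent
        of \<open>n\<close> is wanted, and the squares of the Hermite functions have integral
        1.\<close>
      show "norm (\<phi> x * hermite_fun n x) \<le> norm (\<phi> x * \<phi> x) + (norm (hermite_fun n x))\<^sup>2" for x
        using zero_le_power2[of "norm (\<phi> x) - norm (hermite_fun n x)"]
          mult_nonneg_nonneg[OF norm_ge_zero[of "\<phi> x"] norm_ge_zero[of "hermite_fun n x"]]
        unfolding norm_mult power2_eq_square left_diff_distrib right_diff_distrib
          mult.commute[of "norm (hermite_fun n x)" "norm (\<phi> x)"]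
        by linarith
      show "integrable lborel (\<lambda>x. \<phi> x * hermite_fun n x)"
        by (rule Schwartz_integrable_Schwartz[OF 0 hermite_in_Schwartz])
    qed (rule Bochner_Integration.integrable_add[OF I J(1)])
    then show ?thesis
      unfolding Bochner_Integration.integral_add[OF I J(1)] J(2) .
  qed
  from power_mono[OF this] show ?case by auto
next
  case (Suc m)
  \<comment> \<open>By \<open>hermite_coeff_raise\<close> each application of x + d/dx gains a
    factor of order sqrt n. Working with squared coefficients makes this a whole power.\<close>
  let ?\<psi> = "\<lambda>x. of_real x * \<phi> x + nth_deriv 1 \<phi> x"
  have "?\<psi> \<in> Schwartz"
    by (intro Schwartz_add Schwartz_mult_id Schwartz_deriv Suc.prems)
  from Suc.IH[OF this] obtain K where K: "\<And>n. (norm (hermite_coeff ?\<psi> n))\<^sup>2 * (real n + 1) ^ m \<le> K"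
    by blast
  \<comment> \<open>The maximum covers \<open>n = 0\<close>, which is not a raised index. For
    \<open>n = Suc k\<close> the factor 2^m comes from n + 1 \<le> 2 (k + 1).\<close>
  have "(norm (hermite_coeff \<phi> n))\<^sup>2 * (real n + 1) ^ Suc m \<le> max ((norm (hermite_coeff \<phi> 0))\<^sup>2) (2 ^ m * K)" for n
  proof (cases n)
    case (Suc k)
    have "(real n + 1) ^ m \<le> (2 * (real k + 1)) ^ m"
      using Suc by (intro power_mono) auto
    then have "(real n + 1) ^ Suc m \<le> (2 * (real k + 1)) * (2 * (real k + 1)) ^ m"
      using Suc by (simp add: mult_mono)
    then have "(norm (hermite_coeff \<phi> n))\<^sup>2 * (real n + 1) ^ Suc m
        \<le> (norm (hermite_coeff \<phi> n))\<^sup>2 * ((2 * (real k + 1)) * (2 * (real k + 1)) ^ m)"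
      by (intro mult_left_mono) auto
    also have "\<dots> = 2 ^ m * ((norm (of_real (sqrt (2 * (real k + 1))) * hermite_coeff \<phi> n))\<^sup>2 * (real k + 1) ^ m)"
      by (simp add: norm_mult power_mult_distrib del: distrib_left_numeral)
    also have "\<dots> = 2 ^ m * ((norm (hermite_coeff ?\<psi> k))\<^sup>2 * (real k + 1) ^ m)"
      by (simp only: Suc hermite_coeff_raise[OF Suc.prems])
    also have "\<dots> \<le> 2 ^ m * K" by (intro mult_left_mono K) auto
    finally show ?thesis by simp
  qed simp
  then show ?case by blast
qed

lemma Schwartz_coeff_rapidly_decreasing:
  assumes "\<phi> \<in> Schwartz"
  shows "rapidly_decreasing (hermite_coeff \<phi>)"
  unfolding rapidly_decreasing_def
proof
  fix m
  obtain K where K: "\<And>n. (norm (hermite_coeff \<phi> n))\<^sup>2 * (real n + 1) ^ (2 * m) \<le> K"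
    using Schwartz_coeff_decay[OF assms] by blast
  have "norm (hermite_coeff \<phi> n) * (real n + 1) ^ m \<le> 1 + K" for n
  proof -
    define t where "t = norm (hermite_coeff \<phi> n) * (real n + 1) ^ m"
    have "t\<^sup>2 \<le> K" using K[of n] by (simp add: t_def power_mult_distrib power_mult[symmetric] mult.commute)
    moreover have "t \<le> 1 + t\<^sup>2"
      by (rule le_one_plus_square)
    ultimately show ?thesis unfolding t_def by linarith
  qed
  then show "\<exists>K. \<forall>n. norm (hermite_coeff \<phi> n) * (real n + 1) ^ m \<le> K" by blast
qed

section \<open>Completeness of the Hermite functions\<close>

text \<open>The exponential is expanded and integrated termwise. All partial sums of the product are
  dominated by |\<psi>| exp |g|, which explains the integrability hypothesis.\<close>

lemma integral_exp_eq_0: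
  fixes \<psi> :: "real \<Rightarrow> complex" and g :: "real \<Rightarrow> real"
  assumes m [measurable]: "\<psi> \<in> borel_measurable lborel" "g \<in> borel_measurable lborel"
    and int: "integrable lborel (\<lambda>x. norm (\<psi> x) * exp \<bar>g x\<bar>)"
    and zero: "\<And>i. (LINT x|lborel. \<psi> x * of_real (g x ^ i)) = 0"
  shows "(LINT x|lborel. \<psi> x * of_real (exp (g x))) = 0"
proof -
  let ?s = "\<lambda>N x. \<Sum>i<N. of_real (inverse (fact i)) * (\<psi> x * of_real (g x ^ i))"
  have int_term: "integrable lborel (\<lambda>x. \<psi> x * of_real (g x ^ i))" for i
  proof (rule Bochner_Integration.integrable_bound)
    show "integrable lborel (\<lambda>x. fact i * (norm (\<psi> x) * exp \<bar>g x\<bar>))" using int by simp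
    have "\<bar>g x\<bar> ^ i \<le> fact i * exp \<bar>g x\<bar>" for x
    proof -
      have "\<bar>g x\<bar> ^ i /\<^sub>R fact i \<le> (\<Sum>j. \<bar>g x\<bar> ^ j /\<^sub>R fact j)"
        using sum_le_suminf[OF summable_exp_generic[of "\<bar>g x\<bar>"] finite.emptyI[THEN finite.insertI, of i]]
        by simp
      then show ?thesis
        unfolding fun_cong[OF exp_def, symmetric] by (simp add: field_simps)
    qed
    then have "norm (\<psi> x) * \<bar>g x\<bar> ^ i \<le> norm (\<psi> x) * (fact i * exp \<bar>g x\<bar>)" for x
      by (intro mult_left_mono) auto
    then show "AE x in lborel. norm (\<psi> x * of_real (g x ^ i)) \<le> norm (fact i * (norm (\<psi> x) * exp \<bar>g x\<bar>))"
      by (simp add: norm_mult norm_power power_abs abs_mult mult_ac)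
  qed measurable
  have "(\<lambda>N. LINT x|lborel. ?s N x) \<longlonglongrightarrow> (LINT x|lborel. \<psi> x * of_real (exp (g x)))"
  proof (rule integral_dominated_convergence[OF _ _ int])
    show "(\<lambda>x. \<psi> x * of_real (exp (g x))) \<in> borel_measurable lborel" by measurable
    show "?s N \<in> borel_measurable lborel" for N by measurable
    have eq: "?s N x = \<psi> x * of_real (\<Sum>i<N. g x ^ i /\<^sub>R fact i)" for N x
      by (simp add: sum_distrib_left of_real_sum mult_ac)
    show "AE x in lborel. (\<lambda>N. ?s N x) \<longlonglongrightarrow> \<psi> x * of_real (exp (g x))"
      unfolding eq using exp_converges[of "g _", unfolded sums_def]
      by (intro AE_I2 tendsto_mult_left tendsto_of_real)
    have "norm (?s N x) \<le> norm (\<psi> x) * exp \<bar>g x\<bar>" for N x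
    proof -
      have "\<bar>\<Sum>i<N. g x ^ i /\<^sub>R fact i\<bar> \<le> (\<Sum>i<N. \<bar>g x\<bar> ^ i /\<^sub>R fact i)"
        by (rule order_trans[OF sum_abs]) (simp add: abs_mult power_abs)
      also have "\<dots> \<le> (\<Sum>i. \<bar>g x\<bar> ^ i /\<^sub>R fact i)"
        by (intro sum_le_suminf summable_exp_generic) auto
      also have "\<dots> = exp \<bar>g x\<bar>" by (rule fun_cong[OF exp_def, symmetric])
      finally show ?thesis
        unfolding eq norm_mult norm_of_real by (rule mult_left_mono) simp
    qed
    then show "AE x in lborel. norm (?s N x) \<le> norm (\<psi> x) * exp \<bar>g x\<bar>" for N by simp
  qed
  moreover have "(LINT x|lborel. ?s N x) = 0" for N
  proof -
    have "(LINT x|lborel. ?s N x)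
        = (\<Sum>i<N. LINT x|lborel. of_real (inverse (fact i)) * (\<psi> x * of_real (g x ^ i)))"
      by (rule Bochner_Integration.integral_sum) (rule integrable_mult_right[OF int_term])
    then show ?thesis by (simp only: integral_mult_right_zero zero mult_zero_right sum.neutral_const)
  qed
  ultimately show ?thesis by (simp add: LIMSEQ_const_iff)
qed

lemma hermite_coeff_mult_id:
  assumes "\<phi> \<in> Schwartz"
  shows "hermite_coeff (\<lambda>x. of_real x * \<phi> x) n
    = hermite_down n * hermite_coeff \<phi> (n - 1) + hermite_up n * hermite_coeff \<phi> (Suc n)"
proof -
  have "hermite_coeff (\<lambda>x. of_real x * \<phi> x) n = (LINT x|lborel. \<phi> x * (of_real x * hermite_fun n x))"
    by (simp only: hermite_coeff_def mult_ac)
  also have "\<dots> = (LINT x|lborel. hermite_down n * (\<phi> x * hermite_fun (n - 1) x)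
      + hermite_up n * (\<phi> x * hermite_fun (Suc n) x))"
    by (simp only: hermite_mult_id distrib_left mult.left_commute)
  also have "\<dots> = (LINT x|lborel. hermite_down n * (\<phi> x * hermite_fun (n - 1) x))
      + (LINT x|lborel. hermite_up n * (\<phi> x * hermite_fun (Suc n) x))"
    by (intro Bochner_Integration.integral_add integrable_mult_right
        Schwartz_integrable_Schwartz assms hermite_in_Schwartz)
  finally show ?thesis by (simp only: integral_mult_right_zero hermite_coeff_def)
qed

lemma hermite_coeff_mult_power_eq_0:
  assumes "\<phi> \<in> Schwartz" "\<And>n. hermite_coeff \<phi> n = 0"
  shows "hermite_coeff (\<lambda>x. of_real (x ^ k) * \<phi> x) n = 0"
proof (induction k arbitrary: n)
  case (Suc k)
  have "hermite_coeff (\<lambda>x. of_real x * (of_real (x ^ k) * \<phi> x)) n = 0"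
    by (simp only: hermite_coeff_mult_id[OF Schwartz_mult_power[OF assms(1)]] Suc.IH) simp
  then show ?case by (simp only: power_Suc of_real_mult mult.assoc)
qed (simp add: assms)

text \<open>All powers \<open>k\<close> are required together because expanding an exponential
  factor produces further powers of x.\<close>

definition gaussian_moments_vanish :: "(real \<Rightarrow> complex) \<Rightarrow> real \<Rightarrow> bool" where
  "gaussian_moments_vanish \<phi> c \<longleftrightarrow>
    (\<forall>k. (LINT x|lborel. (of_real (x ^ k) * \<phi> x) * of_real (exp (- c * x\<^sup>2))) = 0)"

text \<open>\<open>hermite_fun 0\<close> is a nonzero multiple of exp (- x^2 / 2), so these moments
  are the 0-th coefficients of the functions x^k \<phi>.\<close>

lemma gaussian_moments_vanish_half:
  assumes "\<phi> \<in> Schwartz" "\<And>n. hermite_coeff \<phi> n = 0"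
  shows "gaussian_moments_vanish \<phi> (1/2)"
  unfolding gaussian_moments_vanish_def
proof
  fix k
  have "hermite_const 0 \<noteq> 0" by (simp add: hermite_const_def)
  moreover have "of_real (hermite_const 0)
      * (LINT x|lborel. (of_real (x ^ k) * \<phi> x) * of_real (exp (- (1/2) * x\<^sup>2)))
    = hermite_coeff (\<lambda>x. of_real (x ^ k) * \<phi> x) 0"
    unfolding integral_mult_right_zero[symmetric] hermite_coeff_def hermite_fun_eq
    by (intro Bochner_Integration.integral_cong) (simp_all add: mult_ac)
  ultimately show "(LINT x|lborel. (of_real (x ^ k) * \<phi> x) * of_real (exp (- (1/2) * x\<^sup>2))) = 0"
    using hermite_coeff_mult_power_eq_0[OF assms] by simp
qed

text \<open>One of the two factors exp (- c x^2) is expanded. The other cancels the growth of its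
  majorant exp (c x^2) and leaves the integrable x^k \<phi>. For a general Schwartz function
  domination reaches no further, hence doubling instead of an arbitrary exponent at once.\<close>

lemma gaussian_moments_vanish_double:
  assumes \<phi>: "\<phi> \<in> Schwartz" and c: "c \<ge> 0" and G: "gaussian_moments_vanish \<phi> c"
  shows "gaussian_moments_vanish \<phi> (2 * c)"
  unfolding gaussian_moments_vanish_def
proof
  fix k
  let ?p = "\<lambda>x. of_real (x ^ k) * \<phi> x"
  have p [measurable]: "?p \<in> borel_measurable lborel"
    by (rule Schwartz_measurable[OF Schwartz_mult_power[OF \<phi>]])
  have "(LINT x|lborel. (?p x * of_real (exp (- c * x\<^sup>2))) * of_real (exp (- c * x\<^sup>2))) = 0"
  proof (rule integral_exp_eq_0)
    show "(\<lambda>x. ?p x * of_real (exp (- c * x\<^sup>2))) \<in> borel_measurable lborel"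
      by (intro borel_measurable_times p) measurable
    have "norm (?p x * of_real (exp (- c * x\<^sup>2))) * exp \<bar>- c * x\<^sup>2\<bar> = norm (?p x)" for x
    proof -
      have "exp (- c * x\<^sup>2) * exp \<bar>- c * x\<^sup>2\<bar> = 1"
        using c by (simp add: abs_mult flip: exp_add)
      then show ?thesis unfolding norm_mult[of "?p x"] by (simp add: mult.assoc)
    qed
    then show "integrable lborel (\<lambda>x. norm (?p x * of_real (exp (- c * x\<^sup>2))) * exp \<bar>- c * x\<^sup>2\<bar>)"
      using Schwartz_integrable[OF Schwartz_mult_power[OF \<phi>, of k]] by (simp only: integrable_norm)
    fix i
    have "x ^ (k + 2 * i) = x ^ k * (x\<^sup>2) ^ i" for x :: real
      by (simp only: power_add power_mult)
    then have "(LINT x|lborel. ?p x * of_real (exp (- c * x\<^sup>2)) * of_real ((- c * x\<^sup>2) ^ i))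
      = (LINT x|lborel. of_real ((- c) ^ i) * ((of_real (x ^ (k + 2 * i)) * \<phi> x) * of_real (exp (- c * x\<^sup>2))))"
      by (simp only: power_mult_distrib of_real_mult mult_ac)
    also have "\<dots> = 0"
      using G unfolding integral_mult_right_zero gaussian_moments_vanish_def by simp
    finally show "(LINT x|lborel. ?p x * of_real (exp (- c * x\<^sup>2)) * of_real ((- c * x\<^sup>2) ^ i)) = 0" .
  qed measurable
  moreover have "?p x * of_real (exp (- c * x\<^sup>2)) * of_real (exp (- c * x\<^sup>2))
      = ?p x * of_real (exp (- (2 * c) * x\<^sup>2))" for x
    by (simp add: mult.assoc flip: of_real_mult exp_add)
  ultimately show "(LINT x|lborel. ?p x * of_real (exp (- (2 * c) * x\<^sup>2))) = 0" by (simp only:)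
qed

text \<open>In - c (x - a)^2 = - c a^2 - c x^2 + 2 c a x only the exponential of the linear term is
  expanded. Domination holds because - c x^2 + 2 c |a x| \<le> c a^2.\<close>

lemma gaussian_moments_vanish_shift:
  assumes \<phi>: "\<phi> \<in> Schwartz" and c: "c > 0" and G: "gaussian_moments_vanish \<phi> c"
  shows "(LINT x|lborel. \<phi> x * of_real (exp (- c * (x - a)\<^sup>2))) = 0"
proof -
  have [measurable]: "\<phi> \<in> borel_measurable lborel" by (rule Schwartz_measurable[OF \<phi>])
  have "(LINT x|lborel. (\<phi> x * of_real (exp (- c * x\<^sup>2))) * of_real (exp (2 * c * a * x))) = 0"
  proof (rule integral_exp_eq_0)
    show "integrable lborel (\<lambda>x. norm (\<phi> x * of_real (exp (- c * x\<^sup>2))) * exp \<bar>2 * c * a * x\<bar>)"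
    proof (rule Bochner_Integration.integrable_bound)
      show "integrable lborel (\<lambda>x. exp (c * a\<^sup>2) * norm (\<phi> x))"
        using Schwartz_integrable[OF \<phi>] by simp
      have "exp (- c * x\<^sup>2) * exp \<bar>2 * c * a * x\<bar> \<le> exp (c * a\<^sup>2)" for x
      proof -
        have "0 \<le> c * (\<bar>a\<bar> - \<bar>x\<bar>)\<^sup>2" using c by simp
        also have "\<dots> = c * a\<^sup>2 - (2 * c * \<bar>a\<bar> * \<bar>x\<bar>) + c * x\<^sup>2"
          by (simp add: power2_eq_square algebra_simps)
        finally have "- c * x\<^sup>2 + \<bar>2 * c * a * x\<bar> \<le> c * a\<^sup>2"
          using c by (simp add: abs_mult)
        then show ?thesis by (simp flip: exp_add)
      qed
      then have "norm (\<phi> x) * (exp (- c * x\<^sup>2) * exp \<bar>2 * c * a * x\<bar>) \<le> norm (\<phi> x) * exp (c * a\<^sup>2)" for x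
        by (intro mult_left_mono) auto
      then show "AE x in lborel. norm (norm (\<phi> x * of_real (exp (- c * x\<^sup>2))) * exp \<bar>2 * c * a * x\<bar>)
          \<le> norm (exp (c * a\<^sup>2) * norm (\<phi> x))"
        by (simp add: norm_mult abs_mult mult_ac)
    qed measurable
    fix i
    have "(LINT x|lborel. \<phi> x * of_real (exp (- c * x\<^sup>2)) * of_real ((2 * c * a * x) ^ i))
      = (LINT x|lborel. of_real ((2 * c * a) ^ i) * ((of_real (x ^ i) * \<phi> x) * of_real (exp (- c * x\<^sup>2))))"
      unfolding power_mult_distrib[of "2 * c * a"] by (simp only: of_real_mult mult_ac)
    also have "\<dots> = 0"
      using G unfolding integral_mult_right_zero gaussian_moments_vanish_def by simp
    finally show "(LINT x|lborel. \<phi> x * of_real (exp (- c * x\<^sup>2)) * of_real ((2 * c * a * x) ^ i)) = 0" .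
  qed measurable
  moreover have "\<phi> x * of_real (exp (- c * (x - a)\<^sup>2))
    = of_real (exp (- c * a\<^sup>2)) * ((\<phi> x * of_real (exp (- c * x\<^sup>2))) * of_real (exp (2 * c * a * x)))" for x
  proof -
    have "- c * (x - a)\<^sup>2 = - c * a\<^sup>2 + (- c * x\<^sup>2 + 2 * c * a * x)"
      by (simp add: power2_eq_square algebra_simps)
    then show ?thesis by (simp only: exp_add of_real_mult mult_ac)
  qed
  ultimately show ?thesis by (simp only: integral_mult_right_zero mult_zero_right)
qed

text \<open>Doubling the exponent of the Gaussian repeatedly gives arbitrarily narrow Gaussians; these
  approximate the point evaluation at any \<open>a\<close>.\<close>

lemma hermite_complete:
  assumes \<phi>: "\<phi> \<in> Schwartz" and coeff: "\<And>n. hermite_coeff \<phi> n = 0"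
  shows "\<phi> a = 0"
proof -
  have m [measurable]: "\<phi> \<in> borel_measurable lborel" by (rule Schwartz_measurable[OF \<phi>])
  obtain B where B: "B \<ge> 0" "\<And>x. norm (\<phi> x) \<le> B" using Schwartz_bounded[OF \<phi>] by blast
  have V: "gaussian_moments_vanish \<phi> (2 ^ i / 2)" for i
  proof (induction i)
    case (Suc i)
    from gaussian_moments_vanish_double[OF \<phi> _ this] show ?case by simp
  qed (use gaussian_moments_vanish_half[OF \<phi> coeff] in simp)
  \<comment> \<open>The substitution x = a + t y with t = 2^(-i) turns exp (- c (x - a)^2) into exp
    (- y^2) for c = 4^i. Among the exponents 2^j / 2 provided by \<open>V\<close> this is j = 2 i +
    1.\<close>
  define t :: "nat \<Rightarrow> real" where "t i = (1/2) ^ i" for i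
  have zero: "(LINT y|lborel. \<phi> (a + t i * y) * of_real (exp (- y\<^sup>2))) = 0" for i
  proof -
    have ti: "t i > 0" by (simp add: t_def)
    have "4 ^ i * (t i)\<^sup>2 = 1"
      unfolding t_def by (simp add: power2_eq_square flip: power_mult_distrib)
    then have "- (2 ^ (2 * i + 1) / 2) * (a + t i * y - a)\<^sup>2 = - y\<^sup>2" for y
      by (simp add: power_mult power_mult_distrib flip: mult.assoc)
    moreover have "(LINT x|lborel. \<phi> x * of_real (exp (- (2 ^ (2 * i + 1) / 2) * (x - a)\<^sup>2))) = 0"
      by (rule gaussian_moments_vanish_shift[OF \<phi> _ V]) simp
    ultimately show ?thesis
      using ti by (subst (asm) lborel_integral_real_affine[of "t i" _ a]) auto
  qed
  \<comment> \<open>By continuity at \<open>a\<close> the integrals, all 0, tend to \<phi>(a) sqrt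
    \<pi>.\<close>
  have "(\<lambda>i. LINT y|lborel. \<phi> (a + t i * y) * of_real (exp (- y\<^sup>2)))
      \<longlonglongrightarrow> (LINT y|lborel. \<phi> a * of_real (exp (- y\<^sup>2)))"
  proof (rule integral_dominated_convergence)
    show "integrable lborel (\<lambda>y::real. B * exp (- y\<^sup>2))"
      using gaussian_integral by (simp add: has_bochner_integral_iff)
    have m': "\<phi> \<in> borel_measurable borel" using m by simp
    show "(\<lambda>y. \<phi> (a + t i * y) * of_real (exp (- y\<^sup>2))) \<in> borel_measurable lborel" for i
      by (intro borel_measurable_times measurable_compose[OF _ m']) measurable
    show "(\<lambda>y. \<phi> a * of_real (exp (- y\<^sup>2))) \<in> borel_measurable lborel" by measurable
    show "AE y in lborel. norm (\<phi> (a + t i * y) * of_real (exp (- y\<^sup>2))) \<le> B * exp (- y\<^sup>2)" for i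
      using B by (intro AE_I2) (simp add: norm_mult mult_right_mono)
    have t0: "t \<longlonglongrightarrow> 0" unfolding t_def by (rule LIMSEQ_power_zero) simp
    have "isCont \<phi> a" using Schwartz_continuous[OF \<phi>, of UNIV] by (simp add: continuous_on_eq_continuous_at)
    moreover have "(\<lambda>i. a + t i * y) \<longlonglongrightarrow> a" for y
      using tendsto_add[OF tendsto_const tendsto_mult_right[OF t0, of y], of a] by simp
    ultimately have "(\<lambda>i. \<phi> (a + t i * y)) \<longlonglongrightarrow> \<phi> a" for y
      by (rule isCont_tendsto_compose)
    then show "AE y in lborel. (\<lambda>i. \<phi> (a + t i * y) * of_real (exp (- y\<^sup>2))) \<longlonglongrightarrow> \<phi> a * of_real (exp (- y\<^sup>2))"
      by (intro AE_I2 tendsto_mult_right)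
  qed
  then have "(LINT y|lborel. \<phi> a * of_real (exp (- y\<^sup>2))) = 0"
    by (simp add: zero LIMSEQ_const_iff)
  moreover have "(LINT y|lborel. \<phi> a * of_real (exp (- y\<^sup>2))) = \<phi> a * of_real (sqrt pi)"
    using has_bochner_integral_integral_eq[OF gaussian_integral]
    by (simp only: integral_mult_right_zero integral_complex_of_real)
  ultimately have "\<phi> a * of_real (sqrt pi) = 0" by (simp only:)
  then show ?thesis by simp
qed

text \<open>The series is itself a Schwartz function with the same coefficients, so completeness
  applies to the difference and gives equality at every point, not just almost everywhere.\<close>

lemma Schwartz_hermite_expansion:
  assumes \<phi>: "\<phi> \<in> Schwartz"
  shows "hermite_series (hermite_coeff \<phi>) = \<phi>"
proof
  fix x
  note r = Schwartz_coeff_rapidly_decreasing[OF \<phi>]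
  note S = hermite_series_in_Schwartz[OF r]
  have "hermite_coeff (\<lambda>x. hermite_series (hermite_coeff \<phi>) x - \<phi> x) n = 0" for n
  proof -
    have "hermite_coeff (\<lambda>x. hermite_series (hermite_coeff \<phi>) x - \<phi> x) n
      = hermite_coeff (hermite_series (hermite_coeff \<phi>)) n - hermite_coeff \<phi> n"
      unfolding hermite_coeff_def[of "\<lambda>x. _ x - _ x"] left_diff_distrib
      by (subst Bochner_Integration.integral_diff)
         (simp_all only: Schwartz_integrable_Schwartz[OF S hermite_in_Schwartz]
           Schwartz_integrable_Schwartz[OF \<phi> hermite_in_Schwartz] hermite_coeff_def)
    then show ?thesis by (simp add: hermite_coeff_hermite_series[OF r])
  qed
  from hermite_complete[OF Schwartz_diff[OF S \<phi>] this, of x]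
  show "hermite_series (hermite_coeff \<phi>) x = \<phi> x" by simp
qed

section \<open>Functionals bounded by seminorms, and weighted sequence spaces\<close>

text \<open>The function spaces are sets and not types, so subspaces, seminorms and linear maps are
  all relative to a carrier \<open>X\<close>.\<close>

definition fun_subspace :: "('i \<Rightarrow> complex) set \<Rightarrow> bool" where
  "fun_subspace X \<longleftrightarrow> (\<lambda>i. 0) \<in> X \<and> (\<forall>f\<in>X. \<forall>g\<in>X. (\<lambda>i. f i + g i) \<in> X) \<and>
     (\<forall>c. \<forall>f\<in>X. (\<lambda>i. c * f i) \<in> X)"

definition seminorm_on :: "('i \<Rightarrow> complex) set \<Rightarrow> (('i \<Rightarrow> complex) \<Rightarrow> real) \<Rightarrow> bool" where
  "seminorm_on X \<rho> \<longleftrightarrow> (\<forall>f\<in>X. \<forall>g\<in>X. \<rho> (\<lambda>i. f i + g i) \<le> \<rho> f + \<rho> g) \<and>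
     (\<forall>c. \<forall>f\<in>X. \<rho> (\<lambda>i. c * f i) = norm c * \<rho> f) \<and> (\<forall>f\<in>X. 0 \<le> \<rho> f)"

definition linear_on :: "('i \<Rightarrow> complex) set \<Rightarrow> (('i \<Rightarrow> complex) \<Rightarrow> complex) \<Rightarrow> bool" where
  "linear_on X T \<longleftrightarrow> (\<forall>f\<in>X. \<forall>g\<in>X. T (\<lambda>i. f i + g i) = T f + T g) \<and>
     (\<forall>c. \<forall>f\<in>X. T (\<lambda>i. c * f i) = c * T f)"

lemma fun_subspaceD:
  assumes "fun_subspace X"
  shows fun_subspace_zero: "(\<lambda>i. 0) \<in> X"
    and fun_subspace_add: "f \<in> X \<Longrightarrow> g \<in> X \<Longrightarrow> (\<lambda>i. f i + g i) \<in> X"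
    and fun_subspace_cmult: "f \<in> X \<Longrightarrow> (\<lambda>i. c * f i) \<in> X"
  using assms by (auto simp: fun_subspace_def)

lemma fun_subspace_diff:
  assumes "fun_subspace X" "f \<in> X" "g \<in> X"
  shows "(\<lambda>i. f i - g i) \<in> X"
  using fun_subspace_add[OF assms(1,2) fun_subspace_cmult[OF assms(1,3), of "-1"]] by simp

lemma fun_subspace_lincomb:
  fixes e :: "'n \<Rightarrow> 'i \<Rightarrow> complex"
  assumes "fun_subspace X" "finite A" "\<And>n. n \<in> A \<Longrightarrow> e n \<in> X"
  shows "(\<lambda>i. \<Sum>n\<in>A. f n * e n i) \<in> X"
  using assms(2,3)
  by (induction A rule: finite_induct)
     (simp_all add: fun_subspaceD[OF assms(1)])

lemma seminorm_onD:
  assumes "seminorm_on X \<rho>"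
  shows seminorm_on_triangle: "f \<in> X \<Longrightarrow> g \<in> X \<Longrightarrow> \<rho> (\<lambda>i. f i + g i) \<le> \<rho> f + \<rho> g"
    and seminorm_on_cmult: "f \<in> X \<Longrightarrow> \<rho> (\<lambda>i. c * f i) = norm c * \<rho> f"
    and seminorm_on_nonneg: "f \<in> X \<Longrightarrow> 0 \<le> \<rho> f"
  using assms by (auto simp: seminorm_on_def)

lemma linear_on_add: "linear_on X T \<Longrightarrow> f \<in> X \<Longrightarrow> g \<in> X \<Longrightarrow> T (\<lambda>i. f i + g i) = T f + T g"
  and linear_on_cmult: "linear_on X T \<Longrightarrow> f \<in> X \<Longrightarrow> T (\<lambda>i. c * f i) = c * T f"
  by (auto simp: linear_on_def)

lemma linear_on_zero: "linear_on X T \<Longrightarrow> fun_subspace X \<Longrightarrow> T (\<lambda>i. 0) = 0"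
  using linear_on_cmult[of X T "\<lambda>i. 0" 0] fun_subspace_zero[of X] by simp

lemma linear_on_diff:
  assumes "linear_on X T" "fun_subspace X" "f \<in> X" "g \<in> X"
  shows "T (\<lambda>i. f i - g i) = T f - T g"
  using linear_on_add[OF assms(1,3) fun_subspace_cmult[OF assms(2,4), of "-1"]]
    linear_on_cmult[OF assms(1,4), of "-1"] by simp

lemma linear_on_lincomb:
  fixes e :: "'n \<Rightarrow> 'i \<Rightarrow> complex"
  assumes "linear_on X T" "fun_subspace X" "finite A" "\<And>n. n \<in> A \<Longrightarrow> e n \<in> X"
  shows "T (\<lambda>i. \<Sum>n\<in>A. f n * e n i) = (\<Sum>n\<in>A. f n * T (e n))"
  using assms(3,4)
proof (induction A rule: finite_induct)
  case empty
  show ?case using linear_on_zero[OF assms(1,2)] by simp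
next
  case (insert a A)
  have "(\<lambda>i. \<Sum>n\<in>A. f n * e n i) \<in> X" "(\<lambda>i. f a * e a i) \<in> X"
    using insert by (auto intro: fun_subspace_lincomb[OF assms(2)] fun_subspace_cmult[OF assms(2)])
  then show ?case
    using insert linear_on_add[OF assms(1), of "\<lambda>i. f a * e a i"] linear_on_cmult[OF assms(1), of "e a" "f a"]
    by simp
qed

lemma seminorm_on_zero: "seminorm_on X \<rho> \<Longrightarrow> fun_subspace X \<Longrightarrow> \<rho> (\<lambda>i. 0) = 0"
  using seminorm_on_cmult[of X \<rho> "\<lambda>i. 0" 0] fun_subspace_zero[of X] by simp

section \<open>Continuity of functionals as boundedness by seminorms\<close>

lemma topspace_seminorm_topology:
  assumes "fun_subspace X" "\<And>\<rho>. \<rho> \<in> P \<Longrightarrow> seminorm_on X \<rho>" "P \<noteq> {}"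
  shows "topspace (seminorm_topology X P) = X"
proof -
  obtain \<rho> where \<rho>: "\<rho> \<in> P" using assms(3) by blast
  have "f \<in> \<Union> {{g \<in> X. \<rho> (\<lambda>i. g i - f i) < \<epsilon>} | \<rho> f \<epsilon>. \<rho> \<in> P \<and> f \<in> X \<and> \<epsilon> > 0}" if "f \<in> X" for f
  proof (rule UnionI)
    show "{g \<in> X. \<rho> (\<lambda>i. g i - f i) < 1}
        \<in> {{g \<in> X. \<rho> (\<lambda>i. g i - f i) < \<epsilon>} | \<rho> f \<epsilon>. \<rho> \<in> P \<and> f \<in> X \<and> \<epsilon> > 0}"
      using \<rho> that zero_less_one by blast
    show "f \<in> {g \<in> X. \<rho> (\<lambda>i. g i - f i) < 1}"
      using that seminorm_on_zero[OF assms(2)[OF \<rho>] assms(1)] by simp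
  qed
  then show ?thesis unfolding seminorm_topology_def topology_generated_by_topspace by blast
qed

text \<open>Subbasic balls may have any centre h. By the triangle inequality a ball around h that
  contains \<open>f\<close> contains one around \<open>f\<close> of radius \<epsilon> - \<rho>(f -
  h). Intersections unite the finite sets of seminorms and take the smaller radius.\<close>

lemma seminorm_topology_nbhd:
  assumes X: "fun_subspace X" and P: "\<And>\<rho>. \<rho> \<in> P \<Longrightarrow> seminorm_on X \<rho>"
    and U: "openin (seminorm_topology X P) U" and f: "f \<in> X" "f \<in> U"
  obtains F \<delta> where "finite F" "F \<subseteq> P" "\<delta> > 0"
    "\<And>g. g \<in> X \<Longrightarrow> (\<And>\<rho>. \<rho> \<in> F \<Longrightarrow> \<rho> (\<lambda>i. g i - f i) < \<delta>) \<Longrightarrow> g \<in> U"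
proof -
  have "generate_topology_on {{g \<in> X. \<rho> (\<lambda>i. g i - f i) < \<epsilon>} | \<rho> f \<epsilon>. \<rho> \<in> P \<and> f \<in> X \<and> \<epsilon> > 0} U"
    using U unfolding seminorm_topology_def by (rule openin_topology_generated_by)
  then have "\<exists>F \<delta>. finite F \<and> F \<subseteq> P \<and> \<delta> > 0 \<and>
    (\<forall>g\<in>X. (\<forall>\<rho>\<in>F. \<rho> (\<lambda>i. g i - f i) < \<delta>) \<longrightarrow> g \<in> U)"
    using f(2)
  proof (induction rule: generate_topology_on.induct)
    case Empty
    then show ?case by simp
  next
    case (Int a b)
    then have "f \<in> a" "f \<in> b" by auto
    from Int.IH(1)[OF this(1)] obtain F \<delta> where F: "finite F" "F \<subseteq> P" "\<delta> > 0"
      "\<forall>g\<in>X. (\<forall>\<rho>\<in>F. \<rho> (\<lambda>i. g i - f i) < \<delta>) \<longrightarrow> g \<in> a"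
      by blast
    from Int.IH(2)[OF \<open>f \<in> b\<close>] obtain G \<eta> where G: "finite G" "G \<subseteq> P" "\<eta> > 0"
      "\<forall>g\<in>X. (\<forall>\<rho>\<in>G. \<rho> (\<lambda>i. g i - f i) < \<eta>) \<longrightarrow> g \<in> b"
      by blast
    have "g \<in> a \<inter> b" if "g \<in> X" "\<forall>\<rho>\<in>F \<union> G. \<rho> (\<lambda>i. g i - f i) < min \<delta> \<eta>" for g
      using F(4)[rule_format, OF that(1)] G(4)[rule_format, OF that(1)] that(2) by simp
    then show ?case
      using F(1-3) G(1-3) by (intro exI[of _ "F \<union> G"] exI[of _ "min \<delta> \<eta>"]) simp
  next
    case (UN K)
    then obtain k where k: "k \<in> K" "f \<in> k" by blast
    from UN.IH[OF k] obtain F \<delta> where "finite F" "F \<subseteq> P" "\<delta> > 0"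
      "\<forall>g\<in>X. (\<forall>\<rho>\<in>F. \<rho> (\<lambda>i. g i - f i) < \<delta>) \<longrightarrow> g \<in> k"
      by blast
    with k(1) show ?case by (intro exI[of _ F] exI[of _ \<delta>]) blast
  next
    case (Basis s)
    then obtain \<rho> h \<epsilon> where s: "s = {g \<in> X. \<rho> (\<lambda>i. g i - h i) < \<epsilon>}" "\<rho> \<in> P" "h \<in> X" by blast
    have "\<rho> (\<lambda>i. g i - h i) < \<epsilon>" if "g \<in> X" "\<rho> (\<lambda>i. g i - f i) < \<epsilon> - \<rho> (\<lambda>i. f i - h i)" for g
      using seminorm_on_triangle[OF P[OF s(2)] fun_subspace_diff[OF X that(1) f(1)]
          fun_subspace_diff[OF X f(1) s(3)]] that(2)
      by simp
    then show ?case using s Basis.prems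
      by (intro exI[of _ "{\<rho>}"] exI[of _ "\<epsilon> - \<rho> (\<lambda>i. f i - h i)"]) simp
  qed
  then obtain F \<delta> where "finite F" "F \<subseteq> P" "\<delta> > 0"
    "\<forall>g\<in>X. (\<forall>\<rho>\<in>F. \<rho> (\<lambda>i. g i - f i) < \<delta>) \<longrightarrow> g \<in> U"
    by (elim exE conjE)
  then show ?thesis by (intro that[of F \<delta>]) simp_all
qed

text \<open>Continuity at 0 bounds T by 1 where finitely many seminorms are below \<delta>;
  homogeneity extends this to all of \<open>X\<close>.\<close>

lemma continuous_dual_bounded:
  assumes X: "fun_subspace X" and P: "\<And>\<rho>. \<rho> \<in> P \<Longrightarrow> seminorm_on X \<rho>" "P \<noteq> {}"
    and T: "T \<in> continuous_dual X P"
  obtains F C where "finite F" "F \<subseteq> P" "C \<ge> 0" "\<And>g. g \<in> X \<Longrightarrow> norm (T g) \<le> C * (\<Sum>\<rho>\<in>F. \<rho> g)"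
proof -
  have lin: "linear_on X T" and cont: "continuous_map (seminorm_topology X P) euclidean T"
    using T by (auto simp: continuous_dual_def linear_on_def)
  note top = topspace_seminorm_topology[OF X P]
  have "openin (seminorm_topology X P) {f \<in> X. T f \<in> ball 0 1}"
    using openin_continuous_map_preimage[OF cont, of "ball 0 1"] top by simp
  moreover have "(\<lambda>i. 0) \<in> {f \<in> X. T f \<in> ball 0 1}"
    using fun_subspace_zero[OF X] linear_on_zero[OF lin X] by simp
  ultimately obtain F \<delta> where F: "finite F" "F \<subseteq> P" "\<delta> > 0"
    "\<And>g. g \<in> X \<Longrightarrow> (\<And>\<rho>. \<rho> \<in> F \<Longrightarrow> \<rho> (\<lambda>i. g i - 0) < \<delta>) \<Longrightarrow> g \<in> {f \<in> X. T f \<in> ball 0 1}"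
    using seminorm_topology_nbhd[OF X P(1) _ fun_subspace_zero[OF X]] by blast
  have "norm (T g) \<le> 1 / \<delta> * (\<Sum>\<rho>\<in>F. \<rho> g)" if g: "g \<in> X" for g
  proof (rule field_le_epsilon)
    fix e :: real assume "e > 0"
    \<comment> \<open>The summand \<open>e * \<delta>\<close> keeps \<open>r\<close> positive when
      all seminorms of \<open>g\<close> vanish, and contributes exactly \<open>e\<close> to the
      final bound.\<close>
    define r where "r = (\<Sum>\<rho>\<in>F. \<rho> g) + e * \<delta>"
    have nn: "0 \<le> \<rho> g" if "\<rho> \<in> F" for \<rho>
      using seminorm_on_nonneg[OF P(1) g] F(2) that by blast
    have le: "\<rho> g < r" if "\<rho> \<in> F" for \<rho>
    proof -
      have "\<rho> g \<le> (\<Sum>\<rho>\<in>F. \<rho> g)"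
        using member_le_sum[of \<rho> F "\<lambda>\<rho>. \<rho> g"] that nn F(1) by blast
      moreover have "e * \<delta> > 0" using \<open>e > 0\<close> F(3) by simp
      ultimately show ?thesis unfolding r_def by linarith
    qed
    have r: "r > 0"
      unfolding r_def using \<open>e > 0\<close> F(3) nn by (intro add_nonneg_pos sum_nonneg) auto
    define h where "h = (\<lambda>i. of_real (\<delta> / r) * g i)"
    have h: "h \<in> X" unfolding h_def by (rule fun_subspace_cmult[OF X g])
    have "\<rho> (\<lambda>i. h i - 0) < \<delta>" if "\<rho> \<in> F" for \<rho>
    proof -
      have "\<rho> h = \<delta> / r * \<rho> g"
        unfolding h_def
        by (subst seminorm_on_cmult[OF P(1) g]) (use F(2,3) that r in \<open>auto simp: norm_divide\<close>)
      also have "\<dots> < \<delta>" using le[OF that] r F(3) by (simp add: field_simps)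
      finally show ?thesis by simp
    qed
    then have "h \<in> {f \<in> X. T f \<in> ball 0 1}" by (intro F(4) h)
    then have "norm (T h) < 1" by simp
    moreover have "norm (T h) = \<delta> / r * norm (T g)"
      unfolding h_def linear_on_cmult[OF lin g] using r F(3) by (simp add: norm_mult norm_divide)
    ultimately have "norm (T g) \<le> r / \<delta>"
      using r F(3) by (simp add: field_simps)
    also have "\<dots> = 1 / \<delta> * (\<Sum>\<rho>\<in>F. \<rho> g) + e"
      using F(3) by (simp add: r_def field_simps)
    finally show "norm (T g) \<le> 1 / \<delta> * (\<Sum>\<rho>\<in>F. \<rho> g) + e" .
  qed
  then show ?thesis using F(1-3) by (intro that[of F "1 / \<delta>"]) simp_all
qed

lemma continuous_dualI:
  assumes X: "fun_subspace X" and P: "\<And>\<rho>. \<rho> \<in> P \<Longrightarrow> seminorm_on X \<rho>" and \<rho>: "\<rho> \<in> P"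
    and T: "T \<in> extensional X" "linear_on X T" "C \<ge> 0" "\<And>f. f \<in> X \<Longrightarrow> norm (T f) \<le> C * \<rho> f"
  shows "T \<in> continuous_dual X P"
proof -
  have top: "topspace (seminorm_topology X P) = X"
    using \<rho> by (intro topspace_seminorm_topology X P) auto
  have "continuous_map (seminorm_topology X P) euclidean T"
    unfolding continuous_map_def top
  proof (intro conjI allI impI)
    fix V :: "complex set" assume "openin euclidean V"
    then have V: "open V" by simp
    show "openin (seminorm_topology X P) {f \<in> X. T f \<in> V}"
    proof (subst openin_subopen, intro ballI)
      fix f assume "f \<in> {f \<in> X. T f \<in> V}"
      then have f: "f \<in> X" "T f \<in> V" by auto
      obtain e where e: "e > 0" "ball (T f) e \<subseteq> V" using V f(2) open_contains_ball by blast
      \<comment> \<open>The radius has C + 1 in place of C since C may be 0.\<close>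
      define B where "B = {g \<in> X. \<rho> (\<lambda>i. g i - f i) < e / (C + 1)}"
      have pos: "e / (C + 1) > 0" using e(1) T(3) by simp
      have "openin (seminorm_topology X P) B"
        unfolding seminorm_topology_def B_def
        by (rule topology_generated_by_Basis) (use \<rho> f(1) pos in blast)
      moreover have "f \<in> B"
        using f(1) pos seminorm_on_zero[OF P[OF \<rho>] X] by (simp add: B_def)
      moreover have "T g \<in> V" if "g \<in> B" for g
      proof -
        have g: "g \<in> X" "\<rho> (\<lambda>i. g i - f i) < e / (C + 1)" using that by (auto simp: B_def)
        note d = fun_subspace_diff[OF X g(1) f(1)]
        have "norm (T g - T f) \<le> C * \<rho> (\<lambda>i. g i - f i)"
          using T(4)[OF d] linear_on_diff[OF T(2) X g(1) f(1)] by simp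
        also have "\<dots> \<le> (C + 1) * \<rho> (\<lambda>i. g i - f i)"
          using seminorm_on_nonneg[OF P[OF \<rho>] d] by (intro mult_right_mono) auto
        also have "\<dots> < e" using g(2) T(3) by (simp add: field_simps)
        finally show ?thesis using e(2) by (auto simp: dist_norm norm_minus_commute)
      qed
      then have "B \<subseteq> {f \<in> X. T f \<in> V}" by (auto simp: B_def)
      ultimately show "\<exists>B. openin (seminorm_topology X P) B \<and> f \<in> B \<and> B \<subseteq> {f \<in> X. T f \<in> V}" by blast
    qed
  qed simp
  then show ?thesis using T(1,2) by (simp add: continuous_dual_def linear_on_def)
qed

section \<open>Weighted l2 norms through finite sections\<close>

lemma wl2_boundI:
  assumes a: "\<And>n. a n > 0"
    and B: "\<And>N. L2_set (\<lambda>n. norm (f n) * sqrt (a n powi k)) {..<N} \<le> B"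
  shows "f \<in> wl2 a k" "wnorm a k f \<le> B"
proof -
  let ?t = "\<lambda>n. (norm (f n))\<^sup>2 * a n powi k"
  have w: "a n powi k \<ge> 0" for n using a[of n] by (simp add: less_imp_le)
  have B0: "B \<ge> 0" using B[of 0] by simp
  have "sum ?t {..<N} \<le> B\<^sup>2" for N
  proof -
    have "sum ?t {..<N} = (L2_set (\<lambda>n. norm (f n) * sqrt (a n powi k)) {..<N})\<^sup>2"
      unfolding L2_set_def using w by (simp add: power_mult_distrib sum_nonneg)
    then show ?thesis using B[of N] by (simp add: power_mono)
  qed
  moreover have "?t n \<ge> 0" for n using w by simp
  ultimately have s: "summable ?t"
    by (intro summableI_nonneg_bounded)
  moreover have "suminf ?t \<le> B\<^sup>2"
    by (rule suminf_le_const[OF s]) fact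
  ultimately show "f \<in> wl2 a k" "wnorm a k f \<le> B"
    using B0 by (auto simp: wl2_def wnorm_def intro: real_le_lsqrt)
qed

text \<open>Together with \<open>wl2_boundI\<close> this transfers inequalities for
  \<open>L2_set\<close> on finite sections to \<open>wnorm\<close>.\<close>

lemma L2_set_le_wnorm:
  assumes a: "\<And>n. a n > 0" and f: "f \<in> wl2 a k" and "finite A"
  shows "L2_set (\<lambda>n. norm (f n) * sqrt (a n powi k)) A \<le> wnorm a k f"
proof -
  have w: "a n powi k \<ge> 0" for n using a[of n] by (simp add: less_imp_le)
  have "(\<Sum>n\<in>A. (norm (f n) * sqrt (a n powi k))\<^sup>2) = (\<Sum>n\<in>A. (norm (f n))\<^sup>2 * a n powi k)"
    using w by (simp add: power_mult_distrib)
  also have "\<dots> \<le> (\<Sum>n. (norm (f n))\<^sup>2 * a n powi k)"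
    using f w assms(3) by (intro sum_le_suminf) (auto simp: wl2_def)
  finally show ?thesis by (simp add: L2_set_def wnorm_def)
qed

lemma wnorm_coord:
  assumes "\<And>n. a n > 0" "f \<in> wl2 a k"
  shows "norm (f n) * sqrt (a n powi k) \<le> wnorm a k f"
  using L2_set_le_wnorm[OF assms, of "{n}"] assms(1)[of n] by (simp add: L2_set_def)

lemma wnorm_nonneg:
  assumes "\<And>n. a n > 0" "f \<in> wl2 a k"
  shows "0 \<le> wnorm a k f"
  using L2_set_le_wnorm[OF assms, of "{}"] by simp

lemma wnorm_add:
  assumes a: "\<And>n. a n > 0" and f: "f \<in> wl2 a k" and g: "g \<in> wl2 a k"
  shows "(\<lambda>n. f n + g n) \<in> wl2 a k" "wnorm a k (\<lambda>n. f n + g n) \<le> wnorm a k f + wnorm a k g"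
proof -
  let ?s = "\<lambda>n. sqrt (a n powi k)"
  have "L2_set (\<lambda>n. norm (f n + g n) * ?s n) {..<N} \<le> wnorm a k f + wnorm a k g" for N
  proof -
    have "L2_set (\<lambda>n. norm (f n + g n) * ?s n) {..<N} \<le> L2_set (\<lambda>n. norm (f n) * ?s n + norm (g n) * ?s n) {..<N}"
      using a by (intro L2_set_mono)
        (auto simp flip: distrib_right intro!: mult_right_mono norm_triangle_ineq simp: less_imp_le)
    also have "\<dots> \<le> L2_set (\<lambda>n. norm (f n) * ?s n) {..<N} + L2_set (\<lambda>n. norm (g n) * ?s n) {..<N}"
      by (rule L2_set_triangle_ineq)
    also have "\<dots> \<le> wnorm a k f + wnorm a k g"
      by (intro add_mono L2_set_le_wnorm[OF a] f g) auto
    finally show ?thesis .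
  qed
  from wl2_boundI[OF a this] show "(\<lambda>n. f n + g n) \<in> wl2 a k"
    "wnorm a k (\<lambda>n. f n + g n) \<le> wnorm a k f + wnorm a k g" by auto
qed

lemma wnorm_cmult:
  assumes "f \<in> wl2 a k"
  shows "(\<lambda>n. c * f n) \<in> wl2 a k" "wnorm a k (\<lambda>n. c * f n) = norm c * wnorm a k f"
proof -
  have s: "summable (\<lambda>n. (norm (f n))\<^sup>2 * a n powi k)" using assms by (simp add: wl2_def)
  have eq: "(\<lambda>n. (norm (c * f n))\<^sup>2 * a n powi k) = (\<lambda>n. (norm c)\<^sup>2 * ((norm (f n))\<^sup>2 * a n powi k))"
    by (simp add: norm_mult power_mult_distrib mult.assoc)
  show "(\<lambda>n. c * f n) \<in> wl2 a k"
    unfolding wl2_def mem_Collect_eq eq by (rule summable_mult[OF s])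
  show "wnorm a k (\<lambda>n. c * f n) = norm c * wnorm a k f"
    unfolding wnorm_def eq suminf_mult[OF s] by (simp add: real_sqrt_mult)
qed

lemma fun_subspace_wl2: "(\<And>n. a n > 0) \<Longrightarrow> fun_subspace (wl2 a k)"
  unfolding fun_subspace_def by (auto simp: wnorm_add(1) wnorm_cmult(1)) (simp add: wl2_def)

section \<open>Young's inequality and the Vage inequality\<close>

lemma L2_set_sum_le:
  "finite M \<Longrightarrow> L2_set (\<lambda>n. \<Sum>m\<in>M. h m n) A \<le> (\<Sum>m\<in>M. L2_set (h m) A)"
proof (induction M rule: finite_induct)
  case empty
  then show ?case by (simp add: L2_set_def)
next
  case (insert m M)
  then show ?case
    using L2_set_triangle_ineq[of "h m" "\<lambda>n. \<Sum>m\<in>M. h m n" A] by simp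
qed

lemma L2_set_shift_le:
  "L2_set (\<lambda>n. if m \<le> n then v (n - m) else 0) {..<N} \<le> L2_set v {..<N::nat}"
proof -
  have "(\<Sum>n<N. (if m \<le> n then v (n - m) else 0)\<^sup>2) = (\<Sum>n\<in>{m..<N}. (v (n - m))\<^sup>2)"
    by (rule sum.mono_neutral_cong_right) auto
  also have "\<dots> = (\<Sum>j<N - m. (v j)\<^sup>2)"
    by (rule sum.reindex_bij_witness[of _ "\<lambda>j. j + m" "\<lambda>n. n - m"]) auto
  also have "\<dots> \<le> (\<Sum>j<N. (v j)\<^sup>2)"
    by (rule sum_mono2) auto
  finally show ?thesis by (simp add: L2_set_def)
qed

lemma pow2_powi: "((2::real) ^ n) powi int p = 2 ^ (n * p)"
  "((2::real) ^ n) powi (- int p) = inverse (2 ^ (n * p))"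
  by (simp_all add: power_int_minus power_mult)

text \<open>With u and v the sequences f and g times the square root of the weight at p, the
  weighted convolution is at most the sum of the shifts of v by m with factors u_m, so its norm is
  at most the l1 norm of u times the l2 norm of v. Bounding each coordinate of f by its norm at q
  gives u_m \<le> r^m times that norm.\<close>

lemma vage_inequality:
  assumes pq: "p \<ge> q + 1"
    and f: "f \<in> wl2 (\<lambda>n. 2 ^ n) (- int q)" and g: "g \<in> wl2 (\<lambda>n. 2 ^ n) (- int p)"
  shows "seq_conv f g \<in> wl2 (\<lambda>n. 2 ^ n) (- int p)"
    and "wnorm (\<lambda>n. 2 ^ n) (- int p) (seq_conv f g)
      \<le> 1 / (1 - sqrt ((1/2) ^ (p - q))) * wnorm (\<lambda>n. 2 ^ n) (- int q) f * wnorm (\<lambda>n. 2 ^ n) (- int p) g"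
proof -
  define r where "r = sqrt ((1/2) ^ (p - q))"
  have r: "0 \<le> r" "r < 1"
    using pq by (auto simp: r_def power_less_one_iff)
  define s where "s k n = sqrt (((2::real) ^ n) powi (- int k))" for k n
  have s_mult: "s p n = s p m * s p (n - m)" if "m \<le> n" for m n
  proof -
    have "n * p = m * p + (n - m) * p" using that by (simp flip: add_mult_distrib)
    then show ?thesis by (simp add: s_def pow2_powi power_add real_sqrt_mult)
  qed
  have s_pq: "s p m = s q m * r ^ m" for m
  proof -
    have "m * p = m * q + (p - q) * m" using pq by (simp flip: add_mult_distrib2 add: mult.commute)
    then have "inverse ((2::real) ^ (m * p)) = inverse (2 ^ (m * q)) * ((1/2) ^ (p - q)) ^ m"
      by (simp only: power_mult[symmetric] power_add power_one_over inverse_mult_distrib inverse_eq_divide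
          times_divide_times_eq mult_1)
    then show ?thesis
      unfolding s_def r_def pow2_powi by (simp only: real_sqrt_mult real_sqrt_power)
  qed
  have s_nonneg: "s k n \<ge> 0" for k n by (simp add: s_def pow2_powi)
  let ?f = "wnorm (\<lambda>n. 2 ^ n) (- int q) f" and ?g = "wnorm (\<lambda>n. 2 ^ n) (- int p) g"
  have pos: "(2::real) ^ n > 0" for n by simp
  note nn = wnorm_nonneg[OF pos f] wnorm_nonneg[OF pos g]
  define u where "u m = norm (f m) * s p m" for m
  define v where "v m = norm (g m) * s p m" for m
  have u: "0 \<le> u m" "u m \<le> ?f * r ^ m" for m
  proof -
    show "0 \<le> u m" by (simp add: u_def s_nonneg)
    have "u m = norm (f m) * s q m * r ^ m" by (simp add: u_def s_pq)
    also have "\<dots> \<le> ?f * r ^ m"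
      using wnorm_coord[OF pos f, of m] r unfolding s_def by (intro mult_right_mono) auto
    finally show "u m \<le> ?f * r ^ m" .
  qed
  have bound: "L2_set (\<lambda>n. norm (seq_conv f g n) * sqrt ((2 ^ n) powi (- int p))) {..<N} \<le> 1 / (1 - r) * ?f * ?g" for N
  proof -
    have "L2_set (\<lambda>n. norm (seq_conv f g n) * sqrt ((2 ^ n) powi (- int p))) {..<N}
      \<le> L2_set (\<lambda>n. \<Sum>m<N. u m * (if m \<le> n then v (n - m) else 0)) {..<N}"
    proof (rule L2_set_mono)
      fix n assume n: "n \<in> {..<N}"
      have "norm (seq_conv f g n) * s p n \<le> (\<Sum>m\<le>n. norm (f m * g (n - m))) * s p n"
        unfolding seq_conv_def by (intro mult_right_mono norm_sum s_nonneg)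
      also have "\<dots> = (\<Sum>m\<le>n. u m * v (n - m))"
        unfolding sum_distrib_right
        by (intro sum.cong refl) (simp add: u_def v_def norm_mult s_mult)
      \<comment> \<open>With a range independent of \<open>n\<close> this is a finite sum of shifted
        sequences, to which the triangle inequality applies.\<close>
      also have "\<dots> = (\<Sum>m<N. u m * (if m \<le> n then v (n - m) else 0))"
        using n by (intro sum.mono_neutral_cong_left) auto
      finally show "norm (seq_conv f g n) * sqrt ((2 ^ n) powi (- int p))
          \<le> (\<Sum>m<N. u m * (if m \<le> n then v (n - m) else 0))"
        by (simp add: s_def)
    qed (simp add: pow2_powi)
    also have "\<dots> \<le> (\<Sum>m<N. L2_set (\<lambda>n. u m * (if m \<le> n then v (n - m) else 0)) {..<N})"
      by (rule L2_set_sum_le) simp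
    also have "\<dots> \<le> (\<Sum>m<N. ?f * r ^ m * ?g)"
    proof (rule sum_mono)
      fix m
      have "L2_set (\<lambda>n. u m * (if m \<le> n then v (n - m) else 0)) {..<N}
          = u m * L2_set (\<lambda>n. if m \<le> n then v (n - m) else 0) {..<N}"
        by (rule L2_set_right_distrib[symmetric]) (rule u(1))
      also have "\<dots> \<le> u m * ?g"
        using order_trans[OF L2_set_shift_le[of m v N] L2_set_le_wnorm[OF pos g, of "{..<N}", folded s_def v_def]]
        by (intro mult_left_mono u(1)) (simp add: v_def[abs_def] s_def)
      also have "\<dots> \<le> ?f * r ^ m * ?g" by (intro mult_right_mono u(2) nn)
      finally show "L2_set (\<lambda>n. u m * (if m \<le> n then v (n - m) else 0)) {..<N} \<le> ?f * r ^ m * ?g" .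
    qed
    also have "\<dots> = (\<Sum>m<N. r ^ m) * (?f * ?g)"
      unfolding sum_distrib_right by (intro sum.cong) auto
    also have "\<dots> \<le> 1 / (1 - r) * (?f * ?g)"
    proof (intro mult_right_mono)
      have "(\<Sum>m<N. r ^ m) \<le> (\<Sum>m. r ^ m)"
        using r by (intro sum_le_suminf summable_geometric) auto
      then show "(\<Sum>m<N. r ^ m) \<le> 1 / (1 - r)" using suminf_geometric[of r] r by simp
    qed (use nn in simp)
    finally show ?thesis by (simp add: mult.assoc)
  qed
  from wl2_boundI[OF pos bound]
  show "seq_conv f g \<in> wl2 (\<lambda>n. 2 ^ n) (- int p)"
    "wnorm (\<lambda>n. 2 ^ n) (- int p) (seq_conv f g)
      \<le> 1 / (1 - sqrt ((1/2) ^ (p - q))) * ?f * ?g"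
    unfolding r_def by auto
qed

lemma vage_space_pow2: "vage_space (\<lambda>n. 2 ^ n)"
proof -
  have "regular 1 (\<lambda>n. 2 ^ n)"
    by (simp add: regular_def admissible_def one_ereal_def)
  moreover have "1 / (1 - sqrt ((1/2) ^ k)) > 0" if "k \<ge> 1" for k :: nat
    using that by (simp add: power_less_one_iff)
  ultimately show ?thesis
    unfolding vage_space_def using vage_inequality
    by (intro conjI exI[of _ 1] exI[of _ "\<lambda>k. 1 / (1 - sqrt ((1/2) ^ k))"]) auto
qed

section \<open>The space G and its dual\<close>

text \<open>A functional bounded by finitely many seminorms carries convergence in each seminorm to
  convergence of values. It is stated for a general \<open>X\<close> because it serves both the
  Schwartz space and G.\<close>

lemma dual_expansion:
  assumes X: "fun_subspace X" and P: "\<And>\<rho>. \<rho> \<in> P \<Longrightarrow> seminorm_on X \<rho>" "P \<noteq> {}"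
    and T: "T \<in> continuous_dual X P" and e: "\<And>n. e n \<in> X" and \<phi>: "\<phi> \<in> X"
    and lim: "\<And>\<rho>. \<rho> \<in> P \<Longrightarrow> (\<lambda>N. \<rho> (\<lambda>i. \<phi> i - (\<Sum>n<N. f n * e n i))) \<longlonglongrightarrow> 0"
  shows "(\<lambda>n. f n * T (e n)) sums T \<phi>"
proof -
  have lin: "linear_on X T" using T by (auto simp: continuous_dual_def linear_on_def)
  obtain F C where F: "finite F" "F \<subseteq> P" "C \<ge> 0"
    "\<And>g. g \<in> X \<Longrightarrow> norm (T g) \<le> C * (\<Sum>\<rho>\<in>F. \<rho> g)"
    using continuous_dual_bounded[OF X P T] by blast
  let ?S = "\<lambda>N i. \<Sum>n<N. f n * e n i"
  have S: "?S N \<in> X" for N by (intro fun_subspace_lincomb[OF X] e) auto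
  have "(\<lambda>N. C * (\<Sum>\<rho>\<in>F. \<rho> (\<lambda>i. \<phi> i - ?S N i))) \<longlonglongrightarrow> C * (\<Sum>\<rho>\<in>F. 0)"
    using F(2) by (intro tendsto_mult_left tendsto_sum lim) auto
  then have lim0: "(\<lambda>N. C * (\<Sum>\<rho>\<in>F. \<rho> (\<lambda>i. \<phi> i - ?S N i))) \<longlonglongrightarrow> 0" by simp
  have le: "norm (T \<phi> - (\<Sum>n<N. f n * T (e n))) \<le> C * (\<Sum>\<rho>\<in>F. \<rho> (\<lambda>i. \<phi> i - ?S N i))" for N
  proof -
    have "T \<phi> - (\<Sum>n<N. f n * T (e n)) = T (\<lambda>i. \<phi> i - ?S N i)"
      by (subst linear_on_diff[OF lin X \<phi> S]) (simp add: linear_on_lincomb[OF lin X _ e])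
    then show ?thesis using F(4)[OF fun_subspace_diff[OF X \<phi> S[of N]]] by (simp only:)
  qed
  have "(\<lambda>N. T \<phi> - (\<Sum>n<N. f n * T (e n))) \<longlonglongrightarrow> 0"
    by (rule Lim_null_comparison[OF always_eventually[OF allI[OF le]] lim0])
  from tendsto_diff[OF tendsto_const[of "T \<phi>"] this] show ?thesis by (simp add: sums_def)
qed

lemma fun_subspace_Schwartz: "fun_subspace Schwartz"
  unfolding fun_subspace_def by (auto intro: Schwartz_zero Schwartz_add Schwartz_cmult)

lemma seminorm_on_Schwartz: "seminorm_on Schwartz (Schwartz_seminorm k j)"
  unfolding seminorm_on_def
proof (intro conjI ballI allI)
  have nn: "0 \<le> Schwartz_seminorm k j f" if "f \<in> Schwartz" for f
    by (rule order_trans[OF norm_ge_zero Schwartz_seminorm_upper[OF that, where x = 0]])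
  then show "0 \<le> Schwartz_seminorm k j f" if "f \<in> Schwartz" for f using that .
  show "Schwartz_seminorm k j (\<lambda>x. f x + g x) \<le> Schwartz_seminorm k j f + Schwartz_seminorm k j g"
    if "f \<in> Schwartz" "g \<in> Schwartz" for f g
  proof (rule Schwartz_seminorm_least)
    fix x
    have "of_real (x ^ k) * nth_deriv j (\<lambda>x. f x + g x) x
        = of_real (x ^ k) * nth_deriv j f x + of_real (x ^ k) * nth_deriv j g x"
      using fun_cong[OF Schwartz_lincomb(2)[OF that, of j 1 1], of x]
      by (simp only: mult_1 distrib_left)
    then show "norm (of_real (x ^ k) * nth_deriv j (\<lambda>x. f x + g x) x)
        \<le> Schwartz_seminorm k j f + Schwartz_seminorm k j g"
      using norm_triangle_mono[OF Schwartz_seminorm_upper[OF that(1)] Schwartz_seminorm_upper[OF that(2)]]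
      by (simp only:)
  qed
  fix c f assume f: "f \<in> Schwartz"
  \<comment> \<open>For the supremum only \<le> is direct; the reverse comes from applying it to the
    multiple by 1 / c.\<close>
  have le: "Schwartz_seminorm k j (\<lambda>x. c * f x) \<le> norm c * Schwartz_seminorm k j f" if f: "f \<in> Schwartz" for c f
  proof (rule Schwartz_seminorm_least)
    fix x
    have "of_real (x ^ k) * nth_deriv j (\<lambda>x. c * f x) x = c * (of_real (x ^ k) * nth_deriv j f x)"
      using fun_cong[OF Schwartz_lincomb(2)[OF f f, of j c 0], of x]
      by (simp only: mult_zero_left add_0_right mult.left_commute)
    then show "norm (of_real (x ^ k) * nth_deriv j (\<lambda>x. c * f x) x) \<le> norm c * Schwartz_seminorm k j f"
      unfolding norm_mult[of c] using mult_left_mono[OF Schwartz_seminorm_upper[OF f] norm_ge_zero]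
      by (simp only: norm_mult[of c])
  qed
  show "Schwartz_seminorm k j (\<lambda>x. c * f x) = norm c * Schwartz_seminorm k j f"
  proof (cases "c = 0")
    case True
    then show ?thesis using le[OF f, of c] nn[OF Schwartz_cmult[OF f, of c]] by simp
  next
    case False
    have "Schwartz_seminorm k j f \<le> norm (1 / c) * Schwartz_seminorm k j (\<lambda>x. c * f x)"
      using le[OF Schwartz_cmult[OF f, of c], of "1 / c"] False by simp
    then have "norm c * Schwartz_seminorm k j f \<le> Schwartz_seminorm k j (\<lambda>x. c * f x)"
      using False by (simp add: norm_divide field_simps)
    then show ?thesis using le[OF f, of c] by simp
  qed
qed

lemma Schwartz_seminorms:
  "\<rho> \<in> {Schwartz_seminorm k j |k j. True} \<Longrightarrow> seminorm_on Schwartz \<rho>"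
  "{Schwartz_seminorm k j |k j. True} \<noteq> {}"
  using seminorm_on_Schwartz by auto

lemma tempered_hermite_expansion:
  assumes T: "T \<in> tempered_distributions" and \<phi>: "\<phi> \<in> Schwartz"
  shows "(\<lambda>n. hermite_coeff \<phi> n * T (hermite_fun n)) sums T \<phi>"
proof (rule dual_expansion[OF fun_subspace_Schwartz Schwartz_seminorms
      T[unfolded tempered_distributions_def] hermite_in_Schwartz \<phi>])
  fix \<rho> assume "\<rho> \<in> {Schwartz_seminorm k j |k j. True}"
  then obtain k j where \<rho>: "\<rho> = Schwartz_seminorm k j" by blast
  note r = Schwartz_coeff_rapidly_decreasing[OF \<phi>]
  have "\<phi> x - (\<Sum>n<N. hermite_coeff \<phi> n * hermite_fun n x)
      = hermite_series (\<lambda>n. if n < N then 0 else hermite_coeff \<phi> n) x" for N x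
    using hermite_series_split[OF r, of x N] by (simp add: Schwartz_hermite_expansion[OF \<phi>])
  then show "(\<lambda>N. \<rho> (\<lambda>x. \<phi> x - (\<Sum>n<N. hermite_coeff \<phi> n * hermite_fun n x))) \<longlonglongrightarrow> 0"
    unfolding \<rho> using hermite_series_tail_tendsto_0[OF r, of k j] by (simp only:)
qed

section \<open>Sequences with exponential weights\<close>

abbreviation (input) pow2 :: "nat \<Rightarrow> real" where "pow2 \<equiv> (\<lambda>n. 2 ^ n)"

lemma pow2_pos: "pow2 n > 0" by simp

text \<open>Even norm indices \<open>2 * q\<close> are preferred below, since the square root of the
  weight is then a natural power of 2.\<close>

lemma sqrt_pow2_powi: "sqrt (pow2 n powi int (2 * q)) = 2 ^ (n * q)"
proof -
  have "pow2 n powi int (2 * q) = (2 ^ (n * q))\<^sup>2"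
    unfolding pow2_powi power_mult[symmetric] by (simp add: mult_ac)
  then show ?thesis by simp
qed

lemma wl2_pow2_coord:
  assumes "f \<in> wl2 pow2 (int (2 * q))"
  shows "norm (f n) * 2 ^ (n * q) \<le> wnorm pow2 (int (2 * q)) f"
  using wnorm_coord[OF pow2_pos assms, of n] by (simp only: sqrt_pow2_powi)

lemma wnorm_pow2_mono:
  assumes "p \<le> q" "f \<in> wl2 pow2 (int q)" "f \<in> wl2 pow2 (int p)"
  shows "wnorm pow2 (int p) f \<le> wnorm pow2 (int q) f"
proof -
  have "(2::real) ^ (n * p) \<le> 2 ^ (n * q)" for n
    using assms(1) by (intro power_increasing) auto
  then have "(norm (f n))\<^sup>2 * pow2 n powi int p \<le> (norm (f n))\<^sup>2 * pow2 n powi int q" for n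
    unfolding pow2_powi by (intro mult_left_mono) auto
  then show ?thesis
    unfolding wnorm_def using assms(2,3)[unfolded wl2_def, THEN CollectD]
    by (intro real_sqrt_le_mono suminf_le)
qed

lemma seq_spaceD: "f \<in> seq_space a \<Longrightarrow> p \<ge> 1 \<Longrightarrow> f \<in> wl2 a (int p)"
  by (auto simp: seq_space_def)

lemma fun_subspace_seq_space:
  assumes "\<And>n. a n > 0"
  shows "fun_subspace (seq_space a)"
  using fun_subspace_wl2[of a, OF assms]
  unfolding seq_space_def fun_subspace_def by (intro conjI ballI allI INT_I) auto

text \<open>This comparison of polynomial with exponential weights is what puts G inside the
  Schwartz space and lets the norms of G dominate the Schwartz seminorms.\<close>

lemma Suc_power_le_pow2: "(real n + 1) ^ m \<le> 2 ^ (n * m)"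
proof -
  have "real n + 1 \<le> 2 ^ n"
    by (induction n) auto
  then have "(real n + 1) ^ m \<le> (2 ^ n) ^ m" by (intro power_mono) auto
  then show ?thesis by (simp add: power_mult)
qed

lemma seq_space_rapidly_decreasing:
  assumes "f \<in> seq_space pow2"
  shows "rapidly_decreasing f"
  unfolding rapidly_decreasing_def
proof
  fix m
  \<comment> \<open>\<open>Suc m\<close> keeps the index at least 1 also for \<open>m = 0\<close>,
    as \<open>seq_space\<close> demands.\<close>
  have f: "f \<in> wl2 pow2 (int (2 * Suc m))" using assms by (rule seq_spaceD) simp
  have "norm (f n) * (real n + 1) ^ m \<le> wnorm pow2 (int (2 * Suc m)) f" for n
  proof -
    have "(real n + 1) ^ m \<le> (real n + 1) ^ Suc m" by (intro power_increasing) auto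
    also have "\<dots> \<le> 2 ^ (n * Suc m)" by (rule Suc_power_le_pow2)
    finally have "norm (f n) * (real n + 1) ^ m \<le> norm (f n) * 2 ^ (n * Suc m)"
      by (rule mult_left_mono) simp
    also have "\<dots> \<le> wnorm pow2 (int (2 * Suc m)) f" by (rule wl2_pow2_coord[OF f])
    finally show ?thesis .
  qed
  then show "\<exists>K. \<forall>n. norm (f n) * (real n + 1) ^ m \<le> K" by blast
qed

section \<open>G described by Hermite coefficients\<close>

lemma G_space_eq: "G_space = hermite_series ` seq_space pow2"
proof -
  have "(\<forall>x. (\<lambda>n. f n * hermite_fun n x) sums \<phi> x) \<longleftrightarrow> \<phi> = hermite_series f"
    if "f \<in> seq_space pow2" for f \<phi>
  proof -
    note sums = hermite_series_sums[OF seq_space_rapidly_decreasing[OF that]]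
    have "\<phi> = hermite_series f" if "\<forall>x. (\<lambda>n. f n * hermite_fun n x) sums \<phi> x"
      by (rule ext) (rule sums_unique2[OF that[rule_format] sums])
    then show ?thesis using sums by blast
  qed
  then show ?thesis by (auto simp: G_space_def)
qed

lemma G_spaceE:
  assumes "\<phi> \<in> G_space"
  obtains "hermite_coeff \<phi> \<in> seq_space pow2" "\<phi> = hermite_series (hermite_coeff \<phi>)"
proof -
  obtain f where f: "f \<in> seq_space pow2" "\<phi> = hermite_series f"
    using assms by (auto simp: G_space_eq)
  have "hermite_coeff \<phi> = f"
    using hermite_coeff_hermite_series[OF seq_space_rapidly_decreasing[OF f(1)]] f(2) by auto
  then show ?thesis using f by (intro that) simp_all
qed

lemma G_space_subset_Schwartz: "G_space \<subseteq> Schwartz"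
  using hermite_series_in_Schwartz seq_space_rapidly_decreasing by (auto simp: G_space_eq)

lemma hermite_coeff_add:
  assumes "\<phi> \<in> Schwartz" "\<psi> \<in> Schwartz"
  shows "hermite_coeff (\<lambda>x. \<phi> x + \<psi> x) n = hermite_coeff \<phi> n + hermite_coeff \<psi> n"
  unfolding hermite_coeff_def distrib_right
  by (intro Bochner_Integration.integral_add Schwartz_integrable_Schwartz assms hermite_in_Schwartz)

text \<open>The direction from right to left rests on completeness. Closure of G under the vector
  operations thereby reduces to sequences.\<close>

lemma G_space_iff: "\<phi> \<in> G_space \<longleftrightarrow> \<phi> \<in> Schwartz \<and> hermite_coeff \<phi> \<in> seq_space pow2"
proof
  assume "\<phi> \<in> G_space"
  then show "\<phi> \<in> Schwartz \<and> hermite_coeff \<phi> \<in> seq_space pow2"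
    by (auto intro: subsetD[OF G_space_subset_Schwartz] elim: G_spaceE)
next
  assume "\<phi> \<in> Schwartz \<and> hermite_coeff \<phi> \<in> seq_space pow2"
  then show "\<phi> \<in> G_space"
    unfolding G_space_eq using Schwartz_hermite_expansion[of \<phi>] by (intro image_eqI[of _ _ "hermite_coeff \<phi>"]) auto
qed

lemma fun_subspace_G_space: "fun_subspace G_space"
proof -
  note s = fun_subspace_seq_space[of pow2, OF pow2_pos]
  show ?thesis
    unfolding fun_subspace_def
  proof (intro conjI ballI allI)
    have "hermite_coeff (\<lambda>x. 0) = (\<lambda>n. 0)" by (auto simp: hermite_coeff_def)
    then show "(\<lambda>x. 0) \<in> G_space"
      using Schwartz_zero fun_subspace_zero[OF s] by (simp add: G_space_iff)
    fix \<phi> assume "\<phi> \<in> G_space"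
    then have \<phi>: "\<phi> \<in> Schwartz" "hermite_coeff \<phi> \<in> seq_space pow2" by (auto simp: G_space_iff)
    have "hermite_coeff (\<lambda>x. c * \<phi> x) = (\<lambda>n. c * hermite_coeff \<phi> n)" for c
      by (rule ext) (rule hermite_coeff_cmult)
    then show "(\<lambda>x. c * \<phi> x) \<in> G_space" for c
      unfolding G_space_iff using Schwartz_cmult[OF \<phi>(1)] fun_subspace_cmult[OF s \<phi>(2)] by simp
    fix \<psi> assume "\<psi> \<in> G_space"
    then have \<psi>: "\<psi> \<in> Schwartz" "hermite_coeff \<psi> \<in> seq_space pow2" by (auto simp: G_space_iff)
    have "hermite_coeff (\<lambda>x. \<phi> x + \<psi> x) = (\<lambda>n. hermite_coeff \<phi> n + hermite_coeff \<psi> n)"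
      by (rule ext) (rule hermite_coeff_add[OF \<phi>(1) \<psi>(1)])
    then show "(\<lambda>x. \<phi> x + \<psi> x) \<in> G_space"
      unfolding G_space_iff using Schwartz_add[OF \<phi>(1) \<psi>(1)] fun_subspace_add[OF s \<phi>(2) \<psi>(2)] by simp
  qed
qed

lemma G_space_coeff_wl2: "\<phi> \<in> G_space \<Longrightarrow> p \<ge> 1 \<Longrightarrow> hermite_coeff \<phi> \<in> wl2 pow2 (int p)"
  by (auto simp: G_space_iff intro: seq_spaceD)

lemma seminorm_on_G_space:
  assumes p: "p \<ge> 1"
  shows "seminorm_on G_space (G_norm p)"
  unfolding seminorm_on_def
proof (intro conjI ballI allI)
  fix \<phi> assume \<phi>: "\<phi> \<in> G_space"
  note \<phi>' = G_space_coeff_wl2[OF \<phi> p]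
  show "0 \<le> G_norm p \<phi>" unfolding G_norm_def by (rule wnorm_nonneg[OF pow2_pos \<phi>'])
  show "G_norm p (\<lambda>x. c * \<phi> x) = norm c * G_norm p \<phi>" for c
    using wnorm_cmult(2)[OF \<phi>', of c] by (simp add: G_norm_def hermite_coeff_cmult[abs_def])
  fix \<psi> assume \<psi>: "\<psi> \<in> G_space"
  have "hermite_coeff (\<lambda>x. \<phi> x + \<psi> x) = (\<lambda>n. hermite_coeff \<phi> n + hermite_coeff \<psi> n)"
    using \<phi> \<psi> by (intro ext hermite_coeff_add) (auto simp: G_space_iff)
  then show "G_norm p (\<lambda>x. \<phi> x + \<psi> x) \<le> G_norm p \<phi> + G_norm p \<psi>"
    using wnorm_add(2)[OF pow2_pos \<phi>' G_space_coeff_wl2[OF \<psi> p]] by (simp add: G_norm_def)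
qed

lemma G_norms_seminorms:
  "\<rho> \<in> {G_norm p |p. p \<ge> 1} \<Longrightarrow> seminorm_on G_space \<rho>" "{G_norm p |p. p \<ge> 1} \<noteq> {}"
  using seminorm_on_G_space by auto

lemma G_norm_mono:
  assumes "\<phi> \<in> G_space" "1 \<le> p" "p \<le> q"
  shows "G_norm p \<phi> \<le> G_norm q \<phi>"
  unfolding G_norm_def using assms by (intro wnorm_pow2_mono G_space_coeff_wl2) auto

lemma G_space_coeff_bound:
  assumes "\<phi> \<in> G_space" "q \<ge> 1"
  shows "norm (hermite_coeff \<phi> n) \<le> G_norm (2 * q) \<phi> / 2 ^ (n * q)"
proof -
  have "hermite_coeff \<phi> \<in> wl2 pow2 (int (2 * q))"
    using assms(2) by (intro G_space_coeff_wl2[OF assms(1)]) simp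
  from wl2_pow2_coord[OF this, of n] show ?thesis
    unfolding G_norm_def by (simp only: pos_le_divide_eq[OF pow2_pos])
qed

text \<open>Used for the weighted norms of a Hermite function and for evaluating on it a functional
  given by a sequence.\<close>

lemma delta_sums: "(\<lambda>m. g (if n = m then 1 else 0) m) sums g 1 n"
  if "\<And>m. g (0::complex) m = 0" for g :: "complex \<Rightarrow> nat \<Rightarrow> 'b::{t2_space,topological_comm_monoid_add}"
proof -
  have "(\<lambda>m. g (if n = m then 1 else 0) m) sums (\<Sum>m\<in>{n}. g (if n = m then 1 else 0) m)"
    using that by (intro sums_finite) auto
  then show ?thesis by simp
qed

lemma hermite_coeff_hermite_fun: "hermite_coeff (hermite_fun n) = (\<lambda>m. if n = m then 1 else 0)"
  by (rule ext) (rule hermite_coeff_hermite)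

lemma hermite_delta_sums:
  "(\<lambda>m. (norm (hermite_coeff (hermite_fun n) m))\<^sup>2 * pow2 m powi k) sums pow2 n powi k"
  using delta_sums[of "\<lambda>c m. (norm c)\<^sup>2 * pow2 m powi k" n] by (simp add: hermite_coeff_hermite_fun)

lemma hermite_in_G_space: "hermite_fun n \<in> G_space"
  unfolding G_space_iff seq_space_def wl2_def
  by (intro conjI hermite_in_Schwartz INT_I CollectI sums_summable[OF hermite_delta_sums])

lemma G_norm_hermite: "G_norm p (hermite_fun n) = sqrt (2 ^ (n * p))"
  unfolding G_norm_def wnorm_def sums_unique[OF hermite_delta_sums, symmetric] by (simp only: pow2_powi)

text \<open>The remainder has coefficients 0 below \<open>N\<close>, so its squared norm is the tail
  of a convergent series.\<close>

lemma G_space_tail_tendsto_0: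
  assumes \<phi>: "\<phi> \<in> G_space" and p: "p \<ge> 1"
  shows "(\<lambda>N. G_norm p (\<lambda>x. \<phi> x - (\<Sum>n<N. hermite_coeff \<phi> n * hermite_fun n x))) \<longlonglongrightarrow> 0"
proof -
  let ?c = "hermite_coeff \<phi>"
  let ?t = "\<lambda>n. (norm (?c n))\<^sup>2 * pow2 n powi int p"
  have c: "?c \<in> seq_space pow2" and \<phi>_eq: "\<phi> = hermite_series ?c" using G_spaceE[OF \<phi>] by auto
  have s: "summable ?t" using seq_spaceD[OF c p] by (simp add: wl2_def)
  note r = seq_space_rapidly_decreasing[OF c]
  have "G_norm p (\<lambda>x. \<phi> x - (\<Sum>n<N. ?c n * hermite_fun n x)) = sqrt (\<Sum>n. ?t (n + N))" for N
  proof -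
    let ?g = "\<lambda>n. if n < N then 0 else ?c n"
    have g: "rapidly_decreasing ?g" using r by (rule rapidly_decreasing_mono) auto
    have "\<phi> x - (\<Sum>n<N. ?c n * hermite_fun n x) = hermite_series ?g x" for x
    proof -
      have "\<phi> x = (\<Sum>n<N. ?c n * hermite_fun n x) + hermite_series ?g x"
        by (rule trans[OF fun_cong[OF \<phi>_eq] hermite_series_split[OF r]])
      then show ?thesis by (simp only: add_diff_cancel_left')
    qed
    then have "hermite_coeff (\<lambda>x. \<phi> x - (\<Sum>n<N. ?c n * hermite_fun n x)) = ?g"
      using hermite_coeff_hermite_series[OF g] by (auto simp: fun_eq_iff)
    moreover have "(\<Sum>n. (norm (?g n))\<^sup>2 * pow2 n powi int p) = (\<Sum>n. ?t (n + N))"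
    proof -
      have "summable (\<lambda>n. (norm (?g n))\<^sup>2 * pow2 n powi int p)"
        by (rule summable_cong[THEN iffD1, OF _ s]) (auto simp: eventually_sequentially intro: exI[of _ N])
      from suminf_split_initial_segment[OF this, of N] show ?thesis by simp
    qed
    ultimately show ?thesis by (simp only: G_norm_def wnorm_def)
  qed
  moreover have "(\<lambda>N. sqrt (\<Sum>n. ?t (n + N))) \<longlonglongrightarrow> sqrt 0"
    by (intro tendsto_real_sqrt suminf_exist_split2 s)
  ultimately show ?thesis by simp
qed

section \<open>Identification of the dual of G with sequences\<close>

lemma G_dual_hermite_expansion:
  assumes T: "T \<in> G_dual" and \<phi>: "\<phi> \<in> G_space"
  shows "(\<lambda>n. hermite_coeff \<phi> n * dual_coeff T n) sums T \<phi>"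
  unfolding dual_coeff_def
  by (rule dual_expansion[OF fun_subspace_G_space G_norms_seminorms T[unfolded G_dual_def] hermite_in_G_space \<phi>])
     (auto intro: G_space_tail_tendsto_0[OF \<phi>])

text \<open>T is bounded by finitely many norms, whose values at \<xi>_n are 2^(n p / 2), so the
  coefficients grow at most like 2^(n P). The weight 2^(-n (2 P + 1)) beats their squares with a
  factor 2^(-n) to spare.\<close>

lemma G_dual_coeff_in_dual:
  assumes T: "T \<in> G_dual"
  shows "dual_coeff T \<in> seq_space_dual pow2"
proof -
  obtain F C where F: "finite F" "F \<subseteq> {G_norm p |p. p \<ge> 1}" "C \<ge> 0"
    "\<And>g. g \<in> G_space \<Longrightarrow> norm (T g) \<le> C * (\<Sum>\<rho>\<in>F. \<rho> g)"
    using continuous_dual_bounded[OF fun_subspace_G_space G_norms_seminorms T[unfolded G_dual_def]] by blast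
  have "F \<subseteq> range G_norm" using F(2) by auto
  from finite_subset_image[OF F(1) this] obtain I where I: "finite I" "F = G_norm ` I" by auto
  \<comment> \<open>For empty \<open>I\<close> the value of \<open>Max\<close> is arbitrary, but
    then there is no \<open>p\<close> to bound.\<close>
  define P where "P = Max I"
  have P: "p \<le> P" if "p \<in> I" for p unfolding P_def using I(1) that by (rule Max_ge)
  define K where "K = C * real (card F)"
  have K: "norm (dual_coeff T n) \<le> K * 2 ^ (n * P)" for n
  proof -
    have "\<rho> (hermite_fun n) \<le> 2 ^ (n * P)" if "\<rho> \<in> F" for \<rho>
    proof -
      have "\<rho> \<in> G_norm ` I" using that unfolding I(2) .
      then obtain p where "p \<in> I" "\<rho> = G_norm p" by (elim imageE)
      with P have p: "p \<le> P" "\<rho> = G_norm p" by simp_all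
      have "(2::real) ^ (n * p) \<le> (2 ^ (n * P))\<^sup>2"
        unfolding power_mult[symmetric] using p by (intro power_increasing) auto
      then show ?thesis unfolding p(2) G_norm_hermite by (intro real_le_lsqrt) auto
    qed
    then have "(\<Sum>\<rho>\<in>F. \<rho> (hermite_fun n)) \<le> real (card F) * 2 ^ (n * P)"
      using sum_bounded_above[of F "\<lambda>\<rho>. \<rho> (hermite_fun n)"] by simp
    then have "C * (\<Sum>\<rho>\<in>F. \<rho> (hermite_fun n)) \<le> C * (real (card F) * 2 ^ (n * P))"
      using F(3) by (rule mult_left_mono)
    then show ?thesis
      using F(4)[OF hermite_in_G_space[of n]] by (simp add: dual_coeff_def K_def mult.assoc)
  qed
  have "dual_coeff T \<in> wl2 pow2 (- int (2 * P + 1))"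
    unfolding wl2_def mem_Collect_eq pow2_powi
  proof (rule summable_comparison_test')
    show "summable (\<lambda>n. K\<^sup>2 * (1/2) ^ n :: real)" by (intro summable_mult summable_geometric) simp
    fix n :: nat
    have "(norm (dual_coeff T n))\<^sup>2 * inverse (2 ^ (n * (2 * P + 1)))
        \<le> (K * 2 ^ (n * P))\<^sup>2 * inverse (2 ^ (n * (2 * P + 1)))"
      by (intro mult_right_mono power_mono K) auto
    also have "\<dots> = K\<^sup>2 * (1/2) ^ n"
    proof -
      have "(2::real) ^ (n * (2 * P + 1)) = (2 ^ (n * P))\<^sup>2 * 2 ^ n"
        unfolding power_mult[symmetric] power_add[symmetric] by (simp add: algebra_simps)
      then show ?thesis by (simp add: power_mult_distrib power_one_over field_simps)
    qed
    finally show "norm ((norm (dual_coeff T n))\<^sup>2 * inverse (2 ^ (n * (2 * P + 1)))) \<le> K\<^sup>2 * (1/2) ^ n"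
      by simp
  qed
  then show ?thesis unfolding seq_space_dual_def by (rule UN_I[rotated]) simp
qed

lemma inj_on_dual_coeff: "inj_on dual_coeff G_dual"
proof (rule inj_onI)
  fix S T assume *: "S \<in> G_dual" "T \<in> G_dual" "dual_coeff S = dual_coeff T"
  show "S = T"
  proof (rule extensionalityI)
    show "S \<in> extensional G_space" "T \<in> extensional G_space"
      using * by (auto simp: G_dual_def continuous_dual_def)
    show "S \<phi> = T \<phi>" if "\<phi> \<in> G_space" for \<phi>
      using G_dual_hermite_expansion[OF *(1) that] G_dual_hermite_expansion[OF *(2) that] *(3)
      by (simp add: sums_unique2)
  qed
qed

lemma G_dualI:
  assumes "T \<in> extensional G_space" "linear_on G_space T" "C \<ge> 0" "p \<ge> 1"
    "\<And>\<phi>. \<phi> \<in> G_space \<Longrightarrow> norm (T \<phi>) \<le> C * G_norm p \<phi>"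
  shows "T \<in> G_dual"
  unfolding G_dual_def
  by (rule continuous_dualI[OF fun_subspace_G_space G_norms_seminorms(1) _ assms(1-3,5)])
     (use assms(4) in auto)

text \<open>The functional is the pairing of \<open>t\<close> with the Hermite coefficients; the
  work is to bound it by a single norm of G.\<close>

lemma dual_coeff_surj:
  assumes "t \<in> seq_space_dual pow2"
  shows "\<exists>T\<in>G_dual. dual_coeff T = t"
proof -
  obtain p where p: "p \<ge> 1" "t \<in> wl2 pow2 (- int p)" using assms by (auto simp: seq_space_dual_def)
  define K where "K = wnorm pow2 (- int p) t"
  have K0: "K \<ge> 0" unfolding K_def by (rule wnorm_nonneg[OF pow2_pos p(2)])
  \<comment> \<open>The true growth is 2^(n p / 2); the cruder 2^(n p) keeps the exponents
    integral.\<close>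
  have K: "norm (t n) \<le> K * 2 ^ (n * p)" for n
  proof -
    have "inverse (2 ^ (n * p)) \<le> sqrt (pow2 n powi (- int p))"
      unfolding pow2_powi
    proof (rule real_le_rsqrt)
      have "(inverse (2 ^ (n * p)) :: real) \<le> 1" by (simp add: inverse_le_1_iff)
      then show "(inverse (2 ^ (n * p)) :: real)\<^sup>2 \<le> inverse (2 ^ (n * p))"
        unfolding power2_eq_square by (intro mult_left_le) auto
    qed
    then have "norm (t n) * inverse (2 ^ (n * p)) \<le> norm (t n) * sqrt (pow2 n powi (- int p))"
      by (rule mult_left_mono) simp
    also have "\<dots> \<le> K" unfolding K_def by (rule wnorm_coord[OF pow2_pos p(2)])
    finally show ?thesis by (simp add: field_simps)
  qed
  define L where "L \<phi> = (\<Sum>n. t n * hermite_coeff \<phi> n)" for \<phi>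
  \<comment> \<open>This norm forces the coefficients to decay like 2^(-n (p + 1)), one factor
    2^(-n) more than \<open>t\<close> grows. The geometric series then sums to the 2 in the
    bound.\<close>
  let ?q = "2 * Suc p"
  have term_bound: "norm (t n * hermite_coeff \<phi> n) \<le> K * G_norm ?q \<phi> * (1/2) ^ n" if "\<phi> \<in> G_space" for \<phi> n
  proof -
    have "norm (t n * hermite_coeff \<phi> n) \<le> (K * 2 ^ (n * p)) * (G_norm ?q \<phi> / 2 ^ (n * Suc p))"
      unfolding norm_mult using K0 by (intro mult_mono K G_space_coeff_bound that) auto
    also have "\<dots> = K * G_norm ?q \<phi> * (1/2) ^ n"
      by (simp add: power_add power_one_over field_simps)
    finally show ?thesis .
  qed
  have geo: "summable (\<lambda>n. B * (1/2) ^ n :: real)" for B by (intro summable_mult summable_geometric) simp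
  have summable_norm_term: "summable (\<lambda>n. norm (t n * hermite_coeff \<phi> n))" if "\<phi> \<in> G_space" for \<phi>
    by (rule summable_comparison_test'[OF geo]) (simp only: real_norm_def abs_norm_cancel, rule term_bound[OF that])
  note summable_term = summable_norm_cancel[OF summable_norm_term]
  have bound: "norm (L \<phi>) \<le> (2 * K) * G_norm ?q \<phi>" if \<phi>: "\<phi> \<in> G_space" for \<phi>
  proof -
    have "norm (L \<phi>) \<le> (\<Sum>n. norm (t n * hermite_coeff \<phi> n))"
      unfolding L_def by (rule summable_norm[OF summable_norm_term[OF \<phi>]])
    also have "\<dots> \<le> (\<Sum>n. K * G_norm ?q \<phi> * (1/2) ^ n)"
      by (intro suminf_le term_bound[OF \<phi>] summable_norm_term[OF \<phi>] geo)
    also have "\<dots> = (2 * K) * G_norm ?q \<phi>"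
      by (subst suminf_mult) (auto simp: suminf_geometric summable_geometric)
    finally show ?thesis .
  qed
  \<comment> \<open>Members of a dual are extensional, so \<open>L\<close> enters through its
    restriction.\<close>
  have "linear_on G_space (restrict L G_space)"
    unfolding linear_on_def
  proof (intro conjI ballI allI)
    fix \<phi> assume \<phi>: "\<phi> \<in> G_space"
    show "restrict L G_space (\<lambda>x. c * \<phi> x) = c * restrict L G_space \<phi>" for c
      using \<phi> fun_subspace_cmult[OF fun_subspace_G_space \<phi>] suminf_mult[OF summable_term[OF \<phi>], of c]
      by (simp add: L_def hermite_coeff_cmult mult.left_commute)
    fix \<psi> assume \<psi>: "\<psi> \<in> G_space"
    have "hermite_coeff (\<lambda>x. \<phi> x + \<psi> x) n = hermite_coeff \<phi> n + hermite_coeff \<psi> n" for n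
      using \<phi> \<psi> by (intro hermite_coeff_add) (auto simp: G_space_iff)
    then show "restrict L G_space (\<lambda>x. \<phi> x + \<psi> x) = restrict L G_space \<phi> + restrict L G_space \<psi>"
      using \<phi> \<psi> fun_subspace_add[OF fun_subspace_G_space \<phi> \<psi>]
        suminf_add[OF summable_term[OF \<phi>] summable_term[OF \<psi>]]
      by (simp add: L_def distrib_left)
  qed
  then have "restrict L G_space \<in> G_dual"
    using bound K0 by (intro G_dualI[of _ "2 * K" ?q]) auto
  moreover have "dual_coeff (restrict L G_space) n = t n" for n
    using sums_unique[OF delta_sums[of "\<lambda>c m. t m * c" n]]
    by (simp add: dual_coeff_def hermite_in_G_space L_def hermite_coeff_hermite_fun)
  ultimately show ?thesis by blast
qed

section \<open>Restriction of tempered distributions to G\<close>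

lemma Schwartz_seminorm_le_G_norm:
  "\<exists>C p. C \<ge> 0 \<and> p \<ge> 1 \<and> (\<forall>\<phi>\<in>G_space. Schwartz_seminorm k j \<phi> \<le> C * G_norm p \<phi>)"
proof -
  obtain C M where CM: "\<And>n x. norm (of_real (x ^ k) * hermite_deriv j n x) \<le> C * (real n + 1) ^ M"
    using hermite_deriv_poly_bound by blast
  have C: "C \<ge> 0" using order_trans[OF norm_ge_zero CM[of 0 0]] by simp
  have CM': "norm (of_real (x ^ k) * hermite_deriv j n x) \<le> C * 2 ^ (n * M)" for n x
    using order_trans[OF CM mult_left_mono[OF Suc_power_le_pow2 C]] .
  \<comment> \<open>By \<open>G_space_coeff_bound\<close> this index gives decay 2^(-n (M + 1))
    against the growth 2^(n M), leaving a geometric series with sum 2.\<close>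
  let ?p = "2 * Suc M"
  have "Schwartz_seminorm k j \<phi> \<le> (2 * C) * G_norm ?p \<phi>" if \<phi>: "\<phi> \<in> G_space" for \<phi>
  proof -
    have c: "hermite_coeff \<phi> \<in> seq_space pow2" "\<phi> = hermite_series (hermite_coeff \<phi>)"
      using G_spaceE[OF \<phi>] by auto
    have G: "G_norm ?p \<phi> \<ge> 0" by (rule seminorm_on_nonneg[OF seminorm_on_G_space \<phi>]) simp
    have "Schwartz_seminorm k j (hermite_series (hermite_coeff \<phi>)) \<le> (\<Sum>n. C * G_norm ?p \<phi> * (1/2) ^ n)"
    proof (rule Schwartz_seminorm_hermite_series_le[OF seq_space_rapidly_decreasing[OF c(1)]])
      show "summable (\<lambda>n. C * G_norm ?p \<phi> * (1/2) ^ n)" by (intro summable_mult summable_geometric) simp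
      fix n x
      have "norm (hermite_coeff \<phi> n * (of_real (x ^ k) * hermite_deriv j n x))
          \<le> (G_norm ?p \<phi> / 2 ^ (n * Suc M)) * (C * 2 ^ (n * M))"
        unfolding norm_mult[of "hermite_coeff \<phi> n"] using G
        by (intro mult_mono CM' G_space_coeff_bound \<phi>) auto
      also have "\<dots> = C * G_norm ?p \<phi> * (1/2) ^ n"
        by (simp add: power_add power_one_over field_simps)
      finally show "norm (hermite_coeff \<phi> n * (of_real (x ^ k) * hermite_deriv j n x))
          \<le> C * G_norm ?p \<phi> * (1/2) ^ n" .
    qed
    also have "\<dots> = (2 * C) * G_norm ?p \<phi>"
      by (subst suminf_mult) (auto simp: suminf_geometric summable_geometric)
    finally show ?thesis using c(2) by simp
  qed
  then show ?thesis using C by (intro exI[of _ "2 * C"] exI[of _ ?p]) auto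
qed

text \<open>The norms of G increase with their index, so finitely many of them merge into the
  largest; \<open>G_dualI\<close> wants a single one.\<close>

lemma sum_Schwartz_seminorms_le_G_norm:
  assumes "finite F" "F \<subseteq> {Schwartz_seminorm k j |k j. True}"
  shows "\<exists>C p. C \<ge> 0 \<and> p \<ge> 1 \<and> (\<forall>\<phi>\<in>G_space. (\<Sum>\<rho>\<in>F. \<rho> \<phi>) \<le> C * G_norm p \<phi>)"
  using assms
proof (induction F rule: finite_induct)
  case empty
  show ?case by (intro exI[of _ 0] exI[of _ 1]) simp
next
  case (insert \<rho> F)
  then obtain C p where 1: "C \<ge> 0" "p \<ge> 1" "\<forall>\<phi>\<in>G_space. (\<Sum>\<rho>\<in>F. \<rho> \<phi>) \<le> C * G_norm p \<phi>" by auto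
  obtain k j where "\<rho> = Schwartz_seminorm k j" using insert.prems by blast
  then obtain D q where 2: "D \<ge> 0" "q \<ge> 1" "\<forall>\<phi>\<in>G_space. \<rho> \<phi> \<le> D * G_norm q \<phi>"
    using Schwartz_seminorm_le_G_norm[of k j] by blast
  have "(\<Sum>\<rho>\<in>insert \<rho> F. \<rho> \<phi>) \<le> (D + C) * G_norm (max p q) \<phi>" if "\<phi> \<in> G_space" for \<phi>
  proof -
    have "D * G_norm q \<phi> \<le> D * G_norm (max p q) \<phi>" "C * G_norm p \<phi> \<le> C * G_norm (max p q) \<phi>"
      using 1 2 by (auto intro!: mult_left_mono G_norm_mono that)
    moreover have "\<rho> \<phi> \<le> D * G_norm q \<phi>" "(\<Sum>\<rho>\<in>F. \<rho> \<phi>) \<le> C * G_norm p \<phi>"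
      using 1(3) 2(3) that by auto
    ultimately show ?thesis using insert.hyps by (simp add: distrib_right)
  qed
  then show ?case using 1 2 by (intro exI[of _ "D + C"] exI[of _ "max p q"]) auto
qed

lemma restrict_tempered_in_G_dual:
  assumes T: "T \<in> tempered_distributions"
  shows "restrict T G_space \<in> G_dual"
proof -
  have lin: "linear_on Schwartz T"
    using T by (auto simp: tempered_distributions_def continuous_dual_def linear_on_def)
  obtain F C where F: "finite F" "F \<subseteq> {Schwartz_seminorm k j |k j. True}" "C \<ge> 0"
    "\<And>g. g \<in> Schwartz \<Longrightarrow> norm (T g) \<le> C * (\<Sum>\<rho>\<in>F. \<rho> g)"
    using continuous_dual_bounded[OF fun_subspace_Schwartz Schwartz_seminorms
        T[unfolded tempered_distributions_def]] by blast
  obtain D p where D: "D \<ge> 0" "p \<ge> 1" "\<forall>\<phi>\<in>G_space. (\<Sum>\<rho>\<in>F. \<rho> \<phi>) \<le> D * G_norm p \<phi>"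
    using sum_Schwartz_seminorms_le_G_norm[OF F(1,2)] by blast
  show ?thesis
  proof (rule G_dualI)
    show "linear_on G_space (restrict T G_space)"
      using linear_on_add[OF lin] linear_on_cmult[OF lin] fun_subspaceD[OF fun_subspace_G_space]
        subsetD[OF G_space_subset_Schwartz]
      by (simp add: linear_on_def)
    show "norm (restrict T G_space \<phi>) \<le> (C * D) * G_norm p \<phi>" if "\<phi> \<in> G_space" for \<phi>
    proof -
      have "norm (T \<phi>) \<le> C * (\<Sum>\<rho>\<in>F. \<rho> \<phi>)" using that G_space_subset_Schwartz by (intro F(4)) auto
      also have "\<dots> \<le> C * (D * G_norm p \<phi>)" using D(3) that F(3) by (intro mult_left_mono) auto
      finally show ?thesis using that by (simp add: mult.assoc)
    qed
  qed (use D F(3) in auto)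
qed

text \<open>Equal restrictions agree on every \<xi>_n, hence by the expansion on all Schwartz
  functions, and extensionality gives equality of the functionals.\<close>

lemma inj_on_restrict_tempered: "inj_on (\<lambda>T. restrict T G_space) tempered_distributions"
proof (rule inj_onI)
  fix S T assume S: "S \<in> tempered_distributions" and T: "T \<in> tempered_distributions"
    and eq: "restrict S G_space = restrict T G_space"
  have "S (hermite_fun n) = T (hermite_fun n)" for n
    using fun_cong[OF eq, of "hermite_fun n"] hermite_in_G_space[of n] by simp
  then have "S \<phi> = T \<phi>" if "\<phi> \<in> Schwartz" for \<phi>
    using tempered_hermite_expansion[OF S that] tempered_hermite_expansion[OF T that]
    by (simp add: sums_unique2)
  then show "S = T"
    using S T unfolding tempered_distributions_def continuous_dual_def
    by (intro extensionalityI[of S Schwartz]) auto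
qed

text \<open>The Vage property concerns sequences, so the bijection \<open>dual_coeff\<close> belongs
  to the claim. As G lies in the Schwartz space, the inclusion of the duals is the restriction map,
  and injectivity is what makes it a containment.\<close>

theorem proposition6p2:
  shows "G_space \<subseteq> Schwartz
    \<and> bij_betw dual_coeff G_dual (seq_space_dual (\<lambda>n. 2 ^ n))
    \<and> vage_space (\<lambda>n. 2 ^ n)
    \<and> (\<lambda>T. restrict T G_space) ` tempered_distributions \<subseteq> G_dual
    \<and> inj_on (\<lambda>T. restrict T G_space) tempered_distributions"
proof (intro conjI)
  show "bij_betw dual_coeff G_dual (seq_space_dual (\<lambda>n. 2 ^ n))"
    unfolding bij_betw_def using inj_on_dual_coeff G_dual_coeff_in_dual dual_coeff_surj by blast
qed (use G_space_subset_Schwartz vage_space_pow2 restrict_tempered_in_G_dual inj_on_restrict_tempered in auto)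

end
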